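(* The annular (resp. toroidal) WeRe set is an invariant of annular (resp. toroidal) pseudo links. Subsequently, any invariant of links in the solid torus (resp. of links in the thickened torus), applied on the elements of an annular WeRe set (resp. of a toroidal WeRe set), induces also an invariant set of the annular pseudo link (resp. of the toroidal pseudo link). Similarly, the ${\rm O}$-WeRe set (resp. the ${\rm H}$-WeRe set) is an invariant of ${\rm O}$-mixed pseudo links (resp. of ${\rm H}$-mixed pseudo links). Subsequently, any invariant of ${\rm O}$-mixed links (resp. of ${\rm H}$-mixed links), applied on the elements of an ${\rm O}$-WeRe set (resp. of an ${\rm H}$-WeRe set), induces also an invariant set of the ${\rm O}$-mixed pseudo link (resp. of the ${\rm H}$-mixed pseudo link).
   Context: Notation: $\mathcal{A}=S^1\times D^1$ is the annulus, $\mathcal{T}=S^1\times S^1$ the torus, $I=[0,1]$; $\mathcal{A}\times I$ is homeomorphic to the solid torus and $\mathcal{T}\times I$ is the thickened torus. Diagrams. An annular (resp. toroidal) pseudo link diagram is a regular knot or link diagram in the interior of $\mathcal{A}$ (resp. in $\mathcal{T}$) in which some crossing information may be missing, i.e. at some double points, called precrossings, it is not known which strand passes over. Moves. The classical Reidemeister moves are $R_1,R_2,R_3$ on classical crossings. The pseudo Reidemeister moves are: $PR_1$ adds or removes a kink whose single crossing is a precrossing; $PR_2$ applies where two arcs meet consecutively in a precrossing and a classical crossing bounding a bigon, and exchanges the positions of the precrossing and the classical crossing (the handedness of the classical crossing as a twist of the two arcs being kept); $PR_3$ and $PR_3'$ slide an arc across a precrossing, passing over (resp. under) both arcs of the precrossing.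 An annular (resp. toroidal) pseudo link is an equivalence class of annular (resp. toroidal) pseudo link diagrams under surface isotopy and all versions of the classical and pseudo Reidemeister moves. Mixed pseudo links. A spatial pseudo link is a collection of closed curves in three-space (or $S^3$) consisting of embedded rigid discs (supporting precrossings) from which emanate embedded arcs. Let ${\rm O}$ be the standard unknot in $S^3$ and ${\rm H}$ the Hopf link in $S^3$ with its two components marked; the complement of ${\rm O}$ represents the solid torus and the complement of ${\rm H}$ represents the thickened torus. An ${\rm O}$-mixed (resp. ${\rm H}$-mixed) pseudo link in $S^3$ is a spatial pseudo link ${\rm O}\cup K$ (resp. ${\rm H}\cup K$) containing ${\rm O}$ (resp. ${\rm H}$) as a point-wise fixed sublink, with moving part $K$, such that there are no precrossing discs between the fixed and the moving part; these are considered up to isotopies of arcs and discs keeping ${\rm O}$ (resp. ${\rm H}$) point-wise fixed. It is an ${\rm O}$-mixed (resp. ${\rm H}$-mixed) link if it has no precrossings. An ${\rm O}$-mixed (resp. ${\rm H}$-mixed) pseudo link diagram is a regular projection on the plane of ${\rm O}$ (resp. on the plane of a fixed diagram of ${\rm H}$), in which some double points of the moving part are precrossings, there are no precrossings between the fixed and the moving part, and all other crossings (between arcs of the moving part, or mixed crossings between fixed and moving part) carry over/under information. The corresponding diagrammatic equivalence is generated by planar isotopies, the classical and pseudo Reidemeister moves for the moving part, and the mixed Reidemeister moves: $MR_2$ (an $R_2$ move between an arc of the moving part and an arc of the fixed part), $MR_3$ (an $R_3$ move involving arcs of both the fixed and the moving part; in the ${\rm H}$-mixed case this includes sliding an arc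 of the moving part across a crossing of ${\rm H}$), and $MPR_3$ (an arc of the fixed part and a precrossing of the moving part pass across each other, the fixed arc being over both or under both arcs of the precrossing). Resolutions. A resolution of an annular (resp. toroidal) pseudo link diagram $K$ is a specific assignment of a crossing type (positive or negative) to every precrossing of $K$; the result is a link diagram in the annulus (resp. torus), which lifts to a link in the solid torus (resp. thickened torus). An ${\rm O}$-resolution (resp. ${\rm H}$-resolution) of an ${\rm O}$-mixed (resp. ${\rm H}$-mixed) pseudo link diagram is a specific assignment of a crossing type (positive or negative) to every precrossing; the result is an ${\rm O}$-mixed (resp. ${\rm H}$-mixed) link in $S^3$. WeRe sets. The annular (resp. toroidal) weighted resolution set, or WeRe set, of an annular (resp. toroidal) pseudo link diagram $K$ is the collection of ordered pairs $(K_i,p_{K_i})$, where $K_i$ represents a resolution of $K$ and $p_{K_i}$ is the probability of obtaining from $K$ the equivalence class of $K_i$ through a random assignment of crossing types, with equal likelihood for positive and negative crossings. The ${\rm O}$-WeRe set (resp. ${\rm H}$-WeRe set) of an ${\rm O}$-mixed (resp. ${\rm H}$-mixed) pseudo link diagram ${\rm O}\cup K$ (resp. ${\rm H}\cup K$) is the collection of ordered pairs $({\rm O}\cup K_i,p_{K_i})$ (resp. $({\rm H}\cup K_i,p_{K_i})$), where ${\rm O}\cup K_i$ (resp. ${\rm H}\cup K_i$) represents a resolution and $p_{K_i}$ is the probability of obtaining its equivalence class through a random assignment of crossing types, with equal likelihood for positive and negative crossings. In all cases the resolutions in the set are taken as representatives of equivalence classes. Applying a link invariant to the elements of a WeRe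 set means replacing each resolution by its value under the invariant, keeping the associated probabilities. *)

theory Defs
  imports "HOL-Probability.Probability"
begin

section \<open>Diagrams\<close>

text \<open>
  The curves of a diagram are parametrised by \<open>n\<close> disjoint circles: the parameter \<open>(k, z)\<close>
  is the point \<open>z\<close> of the \<open>k\<close>-th circle.
\<close>

type_synonym param = "nat \<times> complex"

definition circle :: "nat \<Rightarrow> param set" where
  "circle k = {k} \<times> sphere 0 1"

definition circles :: "nat \<Rightarrow> param set" where
  "circles n = {..<n} \<times> sphere 0 1"

text \<open>
  A double point is recorded by the two parameters that are mapped to it, and
  \<open>(s, t) \<in> over K\<close> means that the strand through \<open>s\<close> passes over the strand through \<open>t\<close>.
  A double point for which neither \<open>(s, t)\<close> nor \<open>(t, s)\<close> is in \<open>over K\<close> is a precrossing.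
\<close>

record 'p diagram =
  comps :: nat
  curve :: "param \<Rightarrow> 'p"
  over :: "(param \<times> param) set"

definition double_points :: "'p diagram \<Rightarrow> (param \<times> param) set" where
  "double_points K = {(s, t). s \<in> circles (comps K) \<and> t \<in> circles (comps K) \<and>
     s \<noteq> t \<and> curve K s = curve K t}"

definition precrossings :: "'p diagram \<Rightarrow> (param \<times> param) set" where
  "precrossings K = {(s, t) \<in> double_points K. (s, t) \<notin> over K \<and> (t, s) \<notin> over K}"

text \<open>
  A setting consists of a surface, the part \<open>inner\<close> of it that diagrams live in (the interior of
  the surface), and a fixed sublink diagram with \<open>nfixed\<close> components, its parametrisation and
  its crossings. In a mixed diagram the components with number below \<open>nfixed\<close> are the fixed
  part and the others are the moving part. Without fixed components (\<open>nfixed = 0\<close>) one gets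
  ordinary diagrams on the surface.
\<close>

record 'p setting =
  surface :: "'p set"
  inner :: "'p set"
  nfixed :: nat
  fixed_curve :: "param \<Rightarrow> 'p"
  fixed_over :: "(param \<times> param) set"

definition annulus :: "(complex \<times> real) setting" where
  "annulus = \<lparr>surface = sphere 0 1 \<times> {-1..1}, inner = sphere 0 1 \<times> {-1<..<1},
     nfixed = 0, fixed_curve = (\<lambda>_. undefined), fixed_over = {}\<rparr>"

definition torus :: "(complex \<times> complex) setting" where
  "torus = \<lparr>surface = sphere 0 1 \<times> sphere 0 1, inner = sphere 0 1 \<times> sphere 0 1,
     nfixed = 0, fixed_curve = (\<lambda>_. undefined), fixed_over = {}\<rparr>"

definition O_mixed :: "complex setting" where
  "O_mixed = \<lparr>surface = UNIV, inner = UNIV,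
     nfixed = 1, fixed_curve = (\<lambda>(k, z). z), fixed_over = {}\<rparr>"

text \<open>
  The fixed diagram of the Hopf link: two unit circles, with centres \<open>-1/2\<close> and \<open>1/2\<close>, that
  cross at \<open>\<plusminus> \<i> sqrt 3 / 2\<close>. Circle \<open>0\<close> is over at the upper crossing, circle \<open>1\<close> at the lower
  one.
\<close>

definition H_mixed :: "complex setting" where
  "H_mixed = \<lparr>surface = UNIV, inner = UNIV,
     nfixed = 2, fixed_curve = (\<lambda>(k, z). if k = 0 then z - 1/2 else z + 1/2),
     fixed_over = {((0, cis (pi/3)), (1, cis (2*pi/3))), ((1, cis (-2*pi/3)), (0, cis (-pi/3)))}\<rparr>"

definition disc_chart :: "'p::metric_space setting \<Rightarrow> (complex \<Rightarrow> 'p) \<Rightarrow> bool" where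
  "disc_chart A \<phi> \<longleftrightarrow> continuous_on (cball 0 1) \<phi> \<and> inj_on \<phi> (cball 0 1) \<and>
     \<phi> ` cball 0 1 \<subseteq> inner A \<and> openin (top_of_set (surface A)) (\<phi> ` ball 0 1)"

text \<open>
  Transversality: in a suitable disc around the double point the diagram is the union of the two
  coordinate axes, one being the strand through \<open>s\<close>, the other the strand through \<open>t\<close>. Since
  \<open>U\<close> and \<open>V\<close> are open, each strand runs straight through the double point, so
  strands that merely touch are excluded. Since the preimage of the disc is \<open>U \<union> V\<close>, triple
  points are excluded.
\<close>

definition transverse ::
    "'p::metric_space setting \<Rightarrow> 'p diagram \<Rightarrow> param \<Rightarrow> param \<Rightarrow> bool" where
  "transverse A K s t \<longleftrightarrow> (\<exists>\<phi> U V. disc_chart A \<phi> \<and> \<phi> 0 = curve K s \<and>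
     s \<in> U \<and> t \<in> V \<and> U \<inter> V = {} \<and>
     openin (top_of_set (circles (comps K))) U \<and> openin (top_of_set (circles (comps K))) V \<and>
     {u \<in> circles (comps K). curve K u \<in> \<phi> ` ball 0 1} = U \<union> V \<and>
     inj_on (curve K) U \<and> curve K ` U = \<phi> ` {z \<in> ball 0 1. Im z = 0} \<and>
     inj_on (curve K) V \<and> curve K ` V = \<phi> ` {z \<in> ball 0 1. Re z = 0})"

definition regular_diagram :: "'p::metric_space setting \<Rightarrow> 'p diagram \<Rightarrow> bool" where
  "regular_diagram A K \<longleftrightarrow>
     continuous_on (circles (comps K)) (curve K) \<and> curve K ` circles (comps K) \<subseteq> inner A \<and>
     finite (double_points K) \<and> (\<forall>(s, t) \<in> double_points K. transverse A K s t)"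

definition pseudo_diagram :: "'p::metric_space setting \<Rightarrow> 'p diagram \<Rightarrow> bool" where
  "pseudo_diagram A K \<longleftrightarrow>
     regular_diagram A K \<and> nfixed A < comps K \<and>
     over K \<subseteq> double_points K \<and> (\<forall>(s, t) \<in> over K. (t, s) \<notin> over K) \<and>
     (\<forall>u \<in> circles (nfixed A). curve K u = fixed_curve A u) \<and>
     over K \<inter> (circles (nfixed A) \<times> circles (nfixed A)) = fixed_over A \<and>
     (\<forall>(s, t) \<in> precrossings K. s \<notin> circles (nfixed A) \<and> t \<notin> circles (nfixed A))"

definition link_diagram :: "'p::metric_space setting \<Rightarrow> 'p diagram \<Rightarrow> bool" where
  "link_diagram A K \<longleftrightarrow> pseudo_diagram A K \<and> precrossings K = {}"

section \<open>Isotopy\<close>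

text \<open>
  Diagrams are considered up to isotopy of the surface and, since the parametrisation of the curves
  is only an auxiliary device, up to reparametrisation \<open>\<rho>\<close> (including change of direction and
  renumbering of the moving components). In the mixed case the isotopy preserves each component of
  the fixed diagram as a set: in space the fixed link does not move at all, but its crossings with
  the moving part slide along it.
\<close>

definition isotopic :: "'p::metric_space setting \<Rightarrow> 'p diagram \<Rightarrow> 'p diagram \<Rightarrow> bool" where
  "isotopic A K K' \<longleftrightarrow> (\<exists>H \<rho> \<sigma>.
     continuous_on ({0..1::real} \<times> surface A) (\<lambda>(r, x). H r x) \<and>
     (\<forall>x \<in> surface A. H 0 x = x) \<and>
     (\<forall>r \<in> {0..1}. \<exists>G. homeomorphism (surface A) (surface A) (H r) G) \<and>
     (\<forall>r \<in> {0..1}. \<forall>k < nfixed A.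
        H r ` fixed_curve A ` circle k = fixed_curve A ` circle k) \<and>
     homeomorphism (circles (comps K)) (circles (comps K')) \<rho> \<sigma> \<and>
     (\<forall>k < nfixed A. \<rho> ` circle k = circle k) \<and>
     (\<forall>u \<in> circles (comps K). curve K' (\<rho> u) = H 1 (curve K u)) \<and>
     over K' = map_prod \<rho> \<rho> ` over K)"

section \<open>Reidemeister moves\<close>

text \<open>
  All moves take place in a disc \<open>\<phi>\<close> that meets the diagram in \<open>n\<close> arcs \<open>j 0, \<dots>, j (n - 1)\<close>
  (given by their parameters) with end points on the boundary of the disc. The arcs may be
  numbered and directed in any way, and the disc may be embedded in either orientation, so every
  description below covers all versions of the respective move. As the fixed part of a mixed
  diagram is the same before and after a move, the moves that involve fixed arcs are exactly the
  mixed moves.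
\<close>

definition strands :: "nat \<Rightarrow> (nat \<Rightarrow> real \<Rightarrow> param) \<Rightarrow> param set" where
  "strands n j = (\<Union>i<n. j i ` {0..1})"

definition tangle :: "'p::metric_space setting \<Rightarrow> 'p diagram \<Rightarrow>
    (complex \<Rightarrow> 'p) \<Rightarrow> nat \<Rightarrow> (nat \<Rightarrow> real \<Rightarrow> param) \<Rightarrow> bool" where
  "tangle A K \<phi> n j \<longleftrightarrow> disc_chart A \<phi> \<and>
     (\<forall>i<n. continuous_on {0..1} (j i)) \<and>
     inj_on (\<lambda>(i, x). j i x) ({..<n} \<times> {0..1}) \<and>
     {u \<in> circles (comps K). curve K u \<in> \<phi> ` cball 0 1} = strands n j \<and>
     (\<forall>i<n. curve K (j i 0) \<in> \<phi> ` sphere 0 1 \<and> curve K (j i 1) \<in> \<phi> ` sphere 0 1 \<and>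
        (\<forall>x \<in> {0<..<1}. curve K (j i x) \<in> \<phi> ` ball 0 1))"

definition local_change :: "'p::metric_space setting \<Rightarrow> 'p diagram \<Rightarrow> 'p diagram \<Rightarrow>
    (complex \<Rightarrow> 'p) \<Rightarrow> nat \<Rightarrow> (nat \<Rightarrow> real \<Rightarrow> param) \<Rightarrow> bool" where
  "local_change A K K' \<phi> n j \<longleftrightarrow>
     tangle A K \<phi> n j \<and> tangle A K' \<phi> n j \<and> comps K' = comps K \<and>
     (\<forall>u \<in> circles (comps K) - strands n j. curve K' u = curve K u) \<and>
     (\<forall>i<n. curve K' (j i 0) = curve K (j i 0) \<and> curve K' (j i 1) = curve K (j i 1)) \<and>
     over K' - strands n j \<times> strands n j = over K - strands n j \<times> strands n j"

definition inner_doubles ::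
    "'p diagram \<Rightarrow> nat \<Rightarrow> (nat \<Rightarrow> real \<Rightarrow> param) \<Rightarrow> (param \<times> param) set" where
  "inner_doubles K n j = double_points K \<inter> strands n j \<times> strands n j"

text \<open>
  \<open>K\<close> has a kink in the disc, that is, an arc with a single self-crossing, while \<open>K'\<close> has an
  arc without self-crossing.
\<close>

definition kink_removal :: "'p::metric_space setting \<Rightarrow> 'p diagram \<Rightarrow> 'p diagram \<Rightarrow>
    param \<Rightarrow> param \<Rightarrow> bool" where
  "kink_removal A K K' s t \<longleftrightarrow> (\<exists>\<phi> j. local_change A K K' \<phi> 1 j \<and>
     inner_doubles K 1 j = {(s, t), (t, s)} \<and> inner_doubles K' 1 j = {})"

definition R1 :: "'p::metric_space setting \<Rightarrow> 'p diagram \<Rightarrow> 'p diagram \<Rightarrow> bool" where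
  "R1 A K K' \<longleftrightarrow> (\<exists>s t. kink_removal A K K' s t \<and> (s, t) \<in> over K)"

definition PR1 :: "'p::metric_space setting \<Rightarrow> 'p diagram \<Rightarrow> 'p diagram \<Rightarrow> bool" where
  "PR1 A K K' \<longleftrightarrow> (\<exists>s t. kink_removal A K K' s t \<and> (s, t) \<in> precrossings K)"

text \<open>Two arcs that cross exactly twice always form a bigon.\<close>

definition bigon :: "'p diagram \<Rightarrow> (nat \<Rightarrow> real \<Rightarrow> param) \<Rightarrow>
    param \<Rightarrow> param \<Rightarrow> param \<Rightarrow> param \<Rightarrow> bool" where
  "bigon K j s t s' t' \<longleftrightarrow> s \<noteq> s' \<and>
     s \<in> j 0 ` {0..1} \<and> s' \<in> j 0 ` {0..1} \<and> t \<in> j 1 ` {0..1} \<and> t' \<in> j 1 ` {0..1} \<and>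
     inner_doubles K 2 j = {(s, t), (t, s), (s', t'), (t', s')}"

definition R2 :: "'p::metric_space setting \<Rightarrow> 'p diagram \<Rightarrow> 'p diagram \<Rightarrow> bool" where
  "R2 A K K' \<longleftrightarrow> (\<exists>\<phi> j s t s' t'. local_change A K K' \<phi> 2 j \<and>
     bigon K j s t s' t' \<and> (s, t) \<in> over K \<and> (s', t') \<in> over K \<and>
     inner_doubles K' 2 j = {})"

text \<open>
  In the move \<open>PR2\<close> the two arcs themselves stay in place. The crossings of a twist of two arcs,
  which have the same handedness, alternate: if the first arc is over the second one at one vertex
  of the bigon, then the second arc is over the first one at the other vertex. So when the
  classical crossing moves to the other vertex and keeps its handedness, the arc that passes over
  changes. The end points of two arcs that cross twice do not separate each other on the boundary
  of the disc; by the choice of the chart one pair is on the upper and the other on the lower half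
  circle.
\<close>

definition PR2 :: "'p::metric_space setting \<Rightarrow> 'p diagram \<Rightarrow> 'p diagram \<Rightarrow> bool" where
  "PR2 A K K' \<longleftrightarrow> (\<exists>\<phi> j s t s' t'. tangle A K \<phi> 2 j \<and>
     (\<forall>x \<in> {0, 1}. curve K (j 0 x) \<in> \<phi> ` {z \<in> sphere 0 1. Im z > 0} \<and>
                   curve K (j 1 x) \<in> \<phi> ` {z \<in> sphere 0 1. Im z < 0}) \<and>
     comps K' = comps K \<and> (\<forall>u \<in> circles (comps K). curve K' u = curve K u) \<and>
     bigon K j s t s' t' \<and> (s, t) \<in> precrossings K \<and> (s', t') \<in> over K \<and>
     over K' = insert (t, s) (over K - {(s', t')}))"

text \<open>
  Three arcs, any two of which cross exactly once; arc \<open>i\<close> meets arc \<open>i'\<close> at its parameter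
  \<open>c i i'\<close> and passes over it iff \<open>(i, i') \<in> W\<close>.
\<close>

definition triangle :: "'p diagram \<Rightarrow> (nat \<Rightarrow> real \<Rightarrow> param) \<Rightarrow>
    (nat \<Rightarrow> nat \<Rightarrow> real) \<Rightarrow> (nat \<times> nat) set \<Rightarrow> bool" where
  "triangle K j c W \<longleftrightarrow>
     (\<forall>i<3. \<forall>i'<3. i \<noteq> i' \<longrightarrow> c i i' \<in> {0..1}) \<and>
     inner_doubles K 3 j = {(j i (c i i'), j i' (c i' i)) | i i'. i < 3 \<and> i' < 3 \<and> i \<noteq> i'} \<and>
     over K \<inter> strands 3 j \<times> strands 3 j = {(j i (c i i'), j i' (c i' i)) | i i'. (i, i') \<in> W}"

text \<open>
  Sliding one arc of a triangle across the crossing of the other two reverses, on each arc, the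
  order of the two crossings.
\<close>

definition triangle_move :: "(nat \<times> nat) set \<Rightarrow>
    'p::metric_space setting \<Rightarrow> 'p diagram \<Rightarrow> 'p diagram \<Rightarrow> bool" where
  "triangle_move W A K K' \<longleftrightarrow> (\<exists>\<phi> j c c'. local_change A K K' \<phi> 3 j \<and>
     triangle K j c W \<and> triangle K' j c' W \<and>
     (\<forall>i<3. \<forall>i'<3. \<forall>i''<3. i \<noteq> i' \<and> i \<noteq> i'' \<and> i' \<noteq> i'' \<longrightarrow>
        (c i i' < c i i'' \<longleftrightarrow> c' i i'' < c' i i')))"

definition R3 :: "'p::metric_space setting \<Rightarrow> 'p diagram \<Rightarrow> 'p diagram \<Rightarrow> bool" where
  "R3 = triangle_move {(0, 1), (0, 2), (1, 2)}"

definition PR3 :: "'p::metric_space setting \<Rightarrow> 'p diagram \<Rightarrow> 'p diagram \<Rightarrow> bool" where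
  "PR3 = triangle_move {(0, 1), (0, 2)}"

definition PR3' :: "'p::metric_space setting \<Rightarrow> 'p diagram \<Rightarrow> 'p diagram \<Rightarrow> bool" where
  "PR3' = triangle_move {(1, 0), (2, 0)}"

section \<open>Links and pseudo links\<close>

text \<open>
  Links in the solid torus and in the thickened torus, mixed links, and the corresponding pseudo
  links are represented by their diagrams, up to isotopy and the respective Reidemeister moves.
\<close>

definition link_step :: "'p::metric_space setting \<Rightarrow> 'p diagram \<Rightarrow> 'p diagram \<Rightarrow> bool" where
  "link_step A L L' \<longleftrightarrow> link_diagram A L \<and> link_diagram A L' \<and>
     (isotopic A L L' \<or> R1 A L L' \<or> R2 A L L' \<or> R3 A L L')"

definition link_equiv :: "'p::metric_space setting \<Rightarrow> 'p diagram \<Rightarrow> 'p diagram \<Rightarrow> bool" where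
  "link_equiv A = equivclp (link_step A)"

definition link_class :: "'p::metric_space setting \<Rightarrow> 'p diagram \<Rightarrow> 'p diagram set" where
  "link_class A L = {L'. link_diagram A L' \<and> link_equiv A L L'}"

definition link_invariant :: "'p::metric_space setting \<Rightarrow> ('p diagram \<Rightarrow> 'v) \<Rightarrow> bool" where
  "link_invariant A f \<longleftrightarrow> (\<forall>L L'. link_diagram A L \<and> link_diagram A L' \<and> link_equiv A L L' \<longrightarrow>
     f L = f L')"

definition pseudo_step :: "'p::metric_space setting \<Rightarrow> 'p diagram \<Rightarrow> 'p diagram \<Rightarrow> bool" where
  "pseudo_step A K K' \<longleftrightarrow> pseudo_diagram A K \<and> pseudo_diagram A K' \<and>
     (isotopic A K K' \<or> R1 A K K' \<or> R2 A K K' \<or> R3 A K K' \<or>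
      PR1 A K K' \<or> PR2 A K K' \<or> PR3 A K K' \<or> PR3' A K K')"

definition pseudo_equiv :: "'p::metric_space setting \<Rightarrow> 'p diagram \<Rightarrow> 'p diagram \<Rightarrow> bool" where
  "pseudo_equiv A = equivclp (pseudo_step A)"

section \<open>Weighted resolution sets\<close>

text \<open>
  The two crossing types of a precrossing correspond to the two choices of the strand that
  passes over.
\<close>

definition resolutions :: "'p diagram \<Rightarrow> 'p diagram set" where
  "resolutions K = {K\<lparr>over := X\<rparr> | X. over K \<subseteq> X \<and> X \<subseteq> double_points K \<and>
     (\<forall>(s, t) \<in> double_points K. (s, t) \<in> X \<longleftrightarrow> (t, s) \<notin> X)}"

text \<open>
  Choosing the crossing types independently with equal likelihood is the uniform distribution
  on the finitely many resolutions.
\<close>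

definition WeRe :: "'p::metric_space setting \<Rightarrow> 'p diagram \<Rightarrow> ('p diagram set \<times> real) set" where
  "WeRe A K = (\<lambda>L. (link_class A L,
     measure_pmf.prob (pmf_of_set (resolutions K)) (link_class A L))) ` resolutions K"

text \<open>
  Every class \<open>C\<close> is replaced by the common value of \<open>f\<close> on its representatives. The result is a
  multiset, so that inequivalent resolutions with equal values and equal probabilities
  remain separate elements.
\<close>

definition WeRe_values ::
    "'p::metric_space setting \<Rightarrow> ('p diagram \<Rightarrow> 'v) \<Rightarrow> 'p diagram \<Rightarrow> ('v \<times> real) multiset" where
  "WeRe_values A f K = image_mset (\<lambda>(C, p). (the_elem (f ` C), p)) (mset_set (WeRe A K))"

end

theory Submission
  imports Defs
begin

text \<open>
  The WeRe set only depends on the distribution of the link class of a uniformly random resolution,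
  so it suffices that no move changes this distribution. A local move leaves the crossings outside
  its disc alone, hence one can fix their types and compare the choices inside the disc:
  \<^item> for \<open>R1\<close>, \<open>PR1\<close>, \<open>R2\<close> every choice inside gives the same class as the simplified diagram;
  \<^item> for \<open>R3\<close>, \<open>PR3\<close>, \<open>PR3'\<close> every choice on the triangle is a linear order of the three arcs, so
    equal choices before and after the move are related by \<open>R3\<close>;
  \<^item> for \<open>PR2\<close> one of the two resolutions before the move is also one after it, and in the
    two remaining ones a single arc is over at both crossings, so that \<open>R2\<close> reduces both to the
    same diagram, in which the two arcs are disjoint.
\<close>

section \<open>Orienting a symmetric relation\<close>

text \<open>Distributions are compared, not resolutions one by one, because a move can change their
  number: \<open>PR1\<close> turns two resolutions into one. The set \<open>choices D Y\<close> is
  detached from diagrams because it is needed for all double points, for those inside or outside a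
  disc, and for the pairs of arc numbers of a triangle. The random object is thus a set of pairs,
  and the same set can be imposed on the diagrams before and after a move. The costly case is
  \<open>PR2\<close>: the diagram in which its two exceptional resolutions meet is not supplied by
  the move. It has to be constructed and shown to be regular. New arcs are pasted into the old
  curve, and each crossing left outside needs a new chart, since its old chart may reach into the
  disc. The four settings are treated at once; they enter through
  \<open>inner A \<subseteq> surface A\<close>.\<close>

definition choices :: "('a \<times> 'a) set \<Rightarrow> ('a \<times> 'a) set \<Rightarrow> ('a \<times> 'a) set set" where
  "choices D Y = {X. Y \<subseteq> X \<and> X \<subseteq> D \<and> (\<forall>(s, t) \<in> D. (s, t) \<in> X \<longleftrightarrow> (t, s) \<notin> X)}"

lemma choicesD:
  assumes "X \<in> choices D Y"
  shows "Y \<subseteq> X" "X \<subseteq> D" "(s, t) \<in> D \<Longrightarrow> (s, t) \<in> X \<longleftrightarrow> (t, s) \<notin> X"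
  using assms by (auto simp: choices_def)

lemma finite_choices: "finite D \<Longrightarrow> finite (choices D Y)"
  by (rule finite_subset[of _ "Pow D"]) (auto simp: choices_def)

text \<open>An injective ranking of the finitely many parameters directs all pairs that
  \<open>Y\<close> leaves open. Nonemptiness matters because \<open>pmf_of_set\<close> is the
  uniform distribution only on finite nonempty sets.\<close>

lemma choices_nonempty:
  assumes "finite D" "sym D" "irrefl D" "Y \<subseteq> D" and asym: "\<And>s t. (s, t) \<in> Y \<Longrightarrow> (t, s) \<notin> Y"
  shows "choices D Y \<noteq> {}"
proof -
  obtain f :: "'a \<Rightarrow> nat" where f: "inj_on f (fst ` D)"
    using finite_imp_inj_to_nat_seg[of "fst ` D"] assms(1) by blast
  define X where "X = Y \<union> {(s, t) \<in> D. (s, t) \<notin> Y \<and> (t, s) \<notin> Y \<and> f s < f t}"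
  have "(s, t) \<in> X \<longleftrightarrow> (t, s) \<notin> X" if st: "(s, t) \<in> D" for s t
  proof -
    have ts: "(t, s) \<in> D" using st \<open>sym D\<close> by (auto dest: symD)
    have "s \<noteq> t" using st \<open>irrefl D\<close> by (auto simp: irrefl_def)
    then have "f s \<noteq> f t"
      using inj_onD[OF f, of s t] st ts by force
    then show ?thesis using st ts asym unfolding X_def by fastforce
  qed
  then have "X \<in> choices D Y"
    using \<open>Y \<subseteq> D\<close> by (auto simp: choices_def X_def)
  then show ?thesis by blast
qed

text \<open>Any further pair would be the reverse of one already in \<open>Y\<close>, and a choice
  never contains both.\<close>

lemma choices_total:
  assumes "Y \<subseteq> D" "\<And>s t. (s, t) \<in> D \<Longrightarrow> (s, t) \<in> Y \<longleftrightarrow> (t, s) \<notin> Y"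
  shows "choices D Y = {Y}"
proof -
  have "X \<subseteq> Y" if "X \<in> choices D Y" for X
  proof
    fix p assume "p \<in> X"
    obtain s t where p: "p = (s, t)" by force
    show "p \<in> Y"
      using choicesD[OF that] assms \<open>p \<in> X\<close> unfolding p by blast
  qed
  moreover have "Y \<in> choices D Y" using assms by (auto simp: choices_def)
  ultimately show ?thesis by (auto dest: choicesD)
qed

text \<open>This is the independence of two groups of crossings: symmetry of \<open>D\<close> and
  \<open>E\<close> puts both orders of a crossing into the same group. Injectivity is what later
  turns the uniform distribution into a product.\<close>

lemma choices_Un:
  assumes "sym D" "sym E" "D \<inter> E = {}" "Y \<subseteq> D \<union> E"
  shows "choices (D \<union> E) Y = (\<lambda>(X, Z). X \<union> Z) ` (choices D (Y \<inter> D) \<times> choices E (Y \<inter> E))"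
    and "inj_on (\<lambda>(X, Z). X \<union> Z) (choices D (Y \<inter> D) \<times> choices E (Y \<inter> E))"
proof -
  have D: "(t, s) \<in> D \<longleftrightarrow> (s, t) \<in> D" for s t using \<open>sym D\<close> by (auto dest: symD)
  have E: "(t, s) \<in> E \<longleftrightarrow> (s, t) \<in> E" for s t using \<open>sym E\<close> by (auto dest: symD)
  have "X \<union> Z \<in> choices (D \<union> E) Y" if "X \<in> choices D (Y \<inter> D)" "Z \<in> choices E (Y \<inter> E)" for X Z
  proof -
    have "(s, t) \<in> X \<union> Z \<longleftrightarrow> (t, s) \<notin> X \<union> Z" if "(s, t) \<in> D \<union> E" for s t
    proof (cases "(s, t) \<in> D")
      case True
      then have "(s, t) \<notin> Z" "(t, s) \<notin> Z"
        using choicesD(2)[OF \<open>Z \<in> _\<close>] D assms(3) by blast+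
      then show ?thesis using choicesD(3)[OF \<open>X \<in> _\<close> True] by blast
    next
      case False
      then have "(s, t) \<notin> X" "(t, s) \<notin> X" "(s, t) \<in> E"
        using choicesD(2)[OF \<open>X \<in> _\<close>] D that by blast+
      then show ?thesis using choicesD(3)[OF \<open>Z \<in> _\<close>] by blast
    qed
    then show ?thesis
      using choicesD(1,2)[OF \<open>X \<in> _\<close>] choicesD(1,2)[OF \<open>Z \<in> _\<close>] assms(4)
      unfolding choices_def by blast
  qed
  moreover have "W \<in> (\<lambda>(X, Z). X \<union> Z) ` (choices D (Y \<inter> D) \<times> choices E (Y \<inter> E))"
    if W: "W \<in> choices (D \<union> E) Y" for W
  proof (rule image_eqI)
    show "W = (case (W \<inter> D, W \<inter> E) of (X, Z) \<Rightarrow> X \<union> Z)" using choicesD(2)[OF W] by auto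
    show "(W \<inter> D, W \<inter> E) \<in> choices D (Y \<inter> D) \<times> choices E (Y \<inter> E)"
      using choicesD[OF W] D E unfolding choices_def by auto
  qed
  ultimately show "choices (D \<union> E) Y = (\<lambda>(X, Z). X \<union> Z) ` (choices D (Y \<inter> D) \<times> choices E (Y \<inter> E))"
    by fast
  show "inj_on (\<lambda>(X, Z). X \<union> Z) (choices D (Y \<inter> D) \<times> choices E (Y \<inter> E))"
  proof (rule inj_onI, clarify)
    fix X Z X' Z'
    assume "X \<in> choices D (Y \<inter> D)" "Z \<in> choices E (Y \<inter> E)"
      "X' \<in> choices D (Y \<inter> D)" "Z' \<in> choices E (Y \<inter> E)" "X \<union> Z = X' \<union> Z'"
    then have "X \<subseteq> D" "Z \<subseteq> E" "X' \<subseteq> D" "Z' \<subseteq> E" "X \<union> Z = X' \<union> Z'" by (auto dest: choicesD)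
    then show "X = X' \<and> Z = Z'" using assms(3) by blast
  qed
qed

text \<open>A map that commutes with \<open>prod.swap\<close> carries one-of-each-pair selections to
  such selections. It is applied to reparametrisations and to the numbering of the crossings of a
  triangle.\<close>

lemma choices_image:
  assumes inj: "inj_on F D" and "Y \<subseteq> D" and "sym D"
    and swap: "\<And>s t. (s, t) \<in> D \<Longrightarrow> F (t, s) = prod.swap (F (s, t))"
  shows "choices (F ` D) (F ` Y) = image F ` choices D Y"
proof -
  have alt: "choices D Y = {X. Y \<subseteq> X \<and> X \<subseteq> D \<and> (\<forall>p \<in> D. p \<in> X \<longleftrightarrow> prod.swap p \<notin> X)}"
    for D Y :: "('x \<times> 'x) set"
    by (auto simp: choices_def)
  have sw: "prod.swap p \<in> D" "F (prod.swap p) = prod.swap (F p)" if "p \<in> D" for p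
    using that swap \<open>sym D\<close> by (cases p; auto dest: symD)+
  have 1: "F ` X \<in> choices (F ` D) (F ` Y)" if X: "X \<in> choices D Y" for X
  proof -
    have "F p \<in> F ` X \<longleftrightarrow> prod.swap (F p) \<notin> F ` X" if p: "p \<in> D" for p
    proof -
      have "X \<subseteq> D" using X by (simp add: alt)
      then have "F p \<in> F ` X \<longleftrightarrow> p \<in> X" "F (prod.swap p) \<in> F ` X \<longleftrightarrow> prod.swap p \<in> X"
        using p sw(1) by (simp_all add: inj_on_image_mem_iff[OF inj])
      then show ?thesis using X p sw(2) by (simp add: alt)
    qed
    then show ?thesis using X unfolding alt by auto
  qed
  have 2: "W \<in> image F ` choices D Y" if W: "W \<in> choices (F ` D) (F ` Y)" for W
  proof -
    define X where "X = {p \<in> D. F p \<in> W}"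
    have "W = F ` X" using choicesD(2)[OF W] unfolding X_def by blast
    moreover have "Y \<subseteq> X" using choicesD(1)[OF W] \<open>Y \<subseteq> D\<close> by (auto simp: X_def)
    moreover have "p \<in> X \<longleftrightarrow> prod.swap p \<notin> X" if "p \<in> D" for p
      using W that sw[OF that] unfolding alt X_def by simp
    ultimately show ?thesis by (auto simp: alt X_def)
  qed
  show ?thesis by (intro equalityI image_subsetI subsetI 1 2)
qed

section \<open>The distribution of the link class\<close>

lemma sym_double_points: "sym (double_points K)"
  by (auto simp: sym_def double_points_def)

lemma irrefl_double_points: "irrefl (double_points K)"
  by (auto simp: irrefl_def double_points_def)

lemma pseudo_diagramD:
  assumes "pseudo_diagram A K"
  shows "finite (double_points K)" "over K \<subseteq> double_points K"
    "(s, t) \<in> over K \<Longrightarrow> (t, s) \<notin> over K"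
  using assms by (auto simp: pseudo_diagram_def regular_diagram_def)

lemma over_update_simps [simp]:
  "double_points (K\<lparr>over := X\<rparr>) = double_points K"
  "inner_doubles (K\<lparr>over := X\<rparr>) n j = inner_doubles K n j"
  "tangle A (K\<lparr>over := X\<rparr>) \<phi> n j = tangle A K \<phi> n j"
  "regular_diagram A (K\<lparr>over := X\<rparr>) = regular_diagram A K"
  by (simp_all add: double_points_def inner_doubles_def tangle_def regular_diagram_def
      transverse_def)

lemma resolutions_eq: "resolutions K = (\<lambda>X. K\<lparr>over := X\<rparr>) ` choices (double_points K) (over K)"
  by (auto simp: resolutions_def choices_def)

lemma inj_over_update: "inj_on (\<lambda>X. K\<lparr>over := X\<rparr>) B"
proof (rule inj_onI)
  fix X Y assume "K\<lparr>over := X\<rparr> = K\<lparr>over := Y\<rparr>"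
  then have "over (K\<lparr>over := X\<rparr>) = over (K\<lparr>over := Y\<rparr>)" by simp
  then show "X = Y" by simp
qed

lemma double_choices:
  assumes "pseudo_diagram A K"
  shows "finite (choices (double_points K) (over K))" "choices (double_points K) (over K) \<noteq> {}"
  using finite_choices choices_nonempty pseudo_diagramD[OF assms]
    sym_double_points irrefl_double_points by metis+

text \<open>The condition at risk is the prescribed crossing data of the fixed link. Every pair
  added to \<open>over K\<close> is a precrossing, and precrossings stay off the fixed
  components.\<close>

lemma link_diagram_choice:
  assumes K: "pseudo_diagram A K" and X: "X \<in> choices (double_points K) (over K)"
  shows "link_diagram A (K\<lparr>over := X\<rparr>)"
proof -
  note X' = choicesD[OF X]
  have pre: "(s, t) \<in> precrossings K" if "(s, t) \<in> X" "(s, t) \<notin> over K" for s t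
    using X' that unfolding precrossings_def by blast
  then have "X \<inter> (circles (nfixed A) \<times> circles (nfixed A)) =
      over K \<inter> (circles (nfixed A) \<times> circles (nfixed A))"
    using K X'(1) unfolding pseudo_diagram_def by blast
  moreover have "precrossings (K\<lparr>over := X\<rparr>) = {}"
    using X' by (auto simp: precrossings_def)
  moreover have "\<forall>(s, t) \<in> X. (t, s) \<notin> X" using X' by blast
  ultimately show ?thesis
    using K X'(2) by (auto simp: link_diagram_def pseudo_diagram_def)
qed

lemma link_step_class:
  assumes "link_step A L L'"
  shows "link_class A L = link_class A L'"
proof -
  have "link_equiv A L L'" "link_equiv A L' L"
    using assms unfolding link_equiv_def by (auto simp: equivclp_sym)
  then show ?thesis
    unfolding link_class_def link_equiv_def by (auto intro: equivclp_trans)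
qed

text \<open>It turns the event of lying in a class into a fibre of \<open>link_class A\<close>,
  whose probability is a value of a pushforward.\<close>

lemma link_class_mem_iff:
  assumes "link_diagram A L'"
  shows "L' \<in> link_class A L \<longleftrightarrow> link_class A L' = link_class A L"
  using assms unfolding link_class_def link_equiv_def
  by (auto intro: equivclp_trans equivclp_sym)

text \<open>The law of the random class, drawn through sets of pairs so that the sample spaces of
  two diagrams can be matched.\<close>

definition class_pmf :: "'p::metric_space setting \<Rightarrow> 'p diagram \<Rightarrow> 'p diagram set pmf" where
  "class_pmf A K = map_pmf (\<lambda>X. link_class A (K\<lparr>over := X\<rparr>))
     (pmf_of_set (choices (double_points K) (over K)))"

text \<open>The WeRe set is the graph of this law over its support, hence carries no more data than
  the law itself.\<close>

lemma WeRe_class_pmf: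
  assumes K: "pseudo_diagram A K"
  shows "WeRe A K = (\<lambda>C. (C, pmf (class_pmf A K) C)) ` set_pmf (class_pmf A K)"
proof -
  let ?Ch = "choices (double_points K) (over K)"
  let ?R = "resolutions K"
  note ch = double_choices[OF K]
  have R: "finite ?R" "?R \<noteq> {}" using ch by (auto simp: resolutions_eq)
  have eq: "class_pmf A K = map_pmf (link_class A) (pmf_of_set ?R)"
    unfolding class_pmf_def resolutions_eq
    by (subst map_pmf_of_set_inj[OF inj_over_update ch(2,1), symmetric])
      (simp add: pmf.map_comp o_def)
  have "measure_pmf.prob (pmf_of_set ?R) (link_class A L) = pmf (class_pmf A K) (link_class A L)"
    for L
  proof -
    have "measure_pmf.prob (pmf_of_set ?R) (link_class A L) =
        measure_pmf.prob (pmf_of_set ?R) (link_class A -` {link_class A L})"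
    \<comment> \<open>The two events are known to agree on link diagrams, and the support consists
      of resolutions, which are link diagrams.\<close>
    proof (rule measure_pmf.finite_measure_eq_AE)
      show "AE L' in pmf_of_set ?R. L' \<in> link_class A L \<longleftrightarrow> L' \<in> link_class A -` {link_class A L}"
        using R link_class_mem_iff link_diagram_choice[OF K]
        by (auto simp: AE_measure_pmf_iff resolutions_eq)
    qed auto
    then show ?thesis by (simp add: eq pmf_map)
  qed
  then show ?thesis
    unfolding WeRe_def by (simp add: eq R image_image)
qed

section \<open>Changes inside a disc\<close>

abbreviation outer_doubles ::
    "'p diagram \<Rightarrow> nat \<Rightarrow> (nat \<Rightarrow> real \<Rightarrow> param) \<Rightarrow> (param \<times> param) set" where
  "outer_doubles K n j \<equiv> double_points K - strands n j \<times> strands n j"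

abbreviation inner_over ::
    "'p diagram \<Rightarrow> nat \<Rightarrow> (nat \<Rightarrow> real \<Rightarrow> param) \<Rightarrow> (param \<times> param) set" where
  "inner_over K n j \<equiv> over K \<inter> strands n j \<times> strands n j"

abbreviation outer_over ::
    "'p diagram \<Rightarrow> nat \<Rightarrow> (nat \<Rightarrow> real \<Rightarrow> param) \<Rightarrow> (param \<times> param) set" where
  "outer_over K n j \<equiv> over K - strands n j \<times> strands n j"

lemma tangle_strands:
  assumes "tangle A K \<phi> n j"
  shows "u \<in> strands n j \<longleftrightarrow> u \<in> circles (comps K) \<and> curve K u \<in> \<phi> ` cball 0 1"
proof -
  have "{u \<in> circles (comps K). curve K u \<in> \<phi> ` cball 0 1} = strands n j"
    using assms by (simp add: tangle_def)
  from this[symmetric] show ?thesis by simp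
qed

text \<open>A crossing is never half inside the disc: its two parameters have the same image, and
  the strands are a full preimage.\<close>

lemma tangle_double_iff:
  assumes "tangle A K \<phi> n j" "(s, t) \<in> double_points K"
  shows "s \<in> strands n j \<longleftrightarrow> t \<in> strands n j"
  using assms(2) by (simp add: tangle_strands[OF assms(1)] double_points_def)

lemma local_change_sym: "local_change A K K' \<phi> n j \<Longrightarrow> local_change A K' K \<phi> n j"
  unfolding local_change_def by auto

text \<open>A crossing outside the disc has both parameters off the strands, where the two curves
  coincide. One inclusion for arbitrary \<open>K\<close>, \<open>K'\<close> suffices by
  \<open>local_change_sym\<close>.\<close>

lemma local_change_double_points:
  assumes "local_change A K K' \<phi> n j"
  shows "outer_doubles K' n j = outer_doubles K n j"
proof -
  have "outer_doubles K n j \<subseteq> double_points K'"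
    if l: "local_change A K K' \<phi> n j" for K K'
  proof (rule subrelI)
    fix s t assume "(s, t) \<in> outer_doubles K n j"
    then have st: "(s, t) \<in> double_points K" "(s, t) \<notin> strands n j \<times> strands n j" by auto
    then have "s \<notin> strands n j" "t \<notin> strands n j"
      using l tangle_double_iff[of A K \<phi> n j s t] by (auto simp: local_change_def)
    then show "(s, t) \<in> double_points K'"
      using st(1) l by (auto simp: local_change_def double_points_def)
  qed
  from this[OF assms] this[OF local_change_sym[OF assms]] show ?thesis by blast
qed

text \<open>A local change compares \<open>over\<close> only outside the disc, so the types inside
  may be set freely on either side.\<close>

lemma local_change_over_update:
  assumes "local_change A K K' \<phi> n j"
    and "X' - strands n j \<times> strands n j = X - strands n j \<times> strands n j"
  shows "local_change A (K\<lparr>over := X\<rparr>) (K'\<lparr>over := X'\<rparr>) \<phi> n j"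
  using assms by (simp add: local_change_def)

lemma sym_inner_doubles: "sym (inner_doubles K n j)"
  by (auto simp: sym_def inner_doubles_def double_points_def)

lemma sym_outer_doubles: "sym (outer_doubles K n j)"
  by (auto simp: sym_def double_points_def)

lemma choices_double_points:
  assumes "pseudo_diagram A K"
  shows "choices (double_points K) (over K) = (\<lambda>(X, Y). X \<union> Y) `
      (choices (outer_doubles K n j) (outer_over K n j) \<times>
       choices (inner_doubles K n j) (inner_over K n j))" (is "_ = ?h ` (?X \<times> ?Y)")
    and "inj_on (\<lambda>(X, Y). X \<union> Y) (choices (outer_doubles K n j) (outer_over K n j) \<times>
       choices (inner_doubles K n j) (inner_over K n j))"
proof -
  have "double_points K = outer_doubles K n j \<union> inner_doubles K n j"
    by (auto simp: inner_doubles_def)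
  moreover have "over K \<inter> outer_doubles K n j = outer_over K n j"
    "over K \<inter> inner_doubles K n j = inner_over K n j"
    using pseudo_diagramD(2)[OF assms] by (auto simp: inner_doubles_def)
  moreover have "outer_doubles K n j \<inter> inner_doubles K n j = {}"
    by (auto simp: inner_doubles_def)
  moreover have "over K \<subseteq> double_points K" using pseudo_diagramD(2)[OF assms] .
  ultimately show "choices (double_points K) (over K) = ?h ` (?X \<times> ?Y)" "inj_on ?h (?X \<times> ?Y)"
    using choices_Un[OF sym_outer_doubles[of K n j] sym_inner_doubles[of K n j], of "over K"]
    by simp_all
qed

lemma link_diagram_outer_inner:
  assumes "pseudo_diagram A K" "X \<in> choices (outer_doubles K n j) (outer_over K n j)"
    and "Y \<in> choices (inner_doubles K n j) (inner_over K n j)"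
  shows "link_diagram A (K\<lparr>over := X \<union> Y\<rparr>)"
  using link_diagram_choice[OF assms(1), of "X \<union> Y"] choices_double_points(1)[OF assms(1), of n j]
    assms(2,3) by force

lemma inner_choices:
  assumes "pseudo_diagram A K"
  shows "finite (choices (inner_doubles K n j) (inner_over K n j))"
    "choices (inner_doubles K n j) (inner_over K n j) \<noteq> {}"
proof -
  have "choices (double_points K) (over K) \<noteq> {}" by (rule double_choices[OF assms])
  then show "choices (inner_doubles K n j) (inner_over K n j) \<noteq> {}"
    unfolding choices_double_points(1)[OF assms, of n j] by blast
  show "finite (choices (inner_doubles K n j) (inner_over K n j))"
    using pseudo_diagramD(1)[OF assms] by (intro finite_choices) (simp add: inner_doubles_def)
qed

lemma pmf_of_set_Times:
  assumes "finite A" "A \<noteq> {}" "finite B" "B \<noteq> {}"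
  shows "pmf_of_set (A \<times> B) = pair_pmf (pmf_of_set A) (pmf_of_set B)"
proof (rule pmf_eqI)
  fix p
  have "A \<times> B \<noteq> {}" using assms by blast
  then show "pmf (pmf_of_set (A \<times> B)) p = pmf (pair_pmf (pmf_of_set A) (pmf_of_set B)) p"
    using assms by (cases p) (simp add: pmf_pair card_cartesian_product indicator_def)
qed

text \<open>The product structure lets the outer types \<open>X\<close> be drawn before the inner
  types \<open>Y\<close>; the inner law does not depend on \<open>X\<close>.\<close>

lemma class_pmf_split:
  assumes "pseudo_diagram A K"
  shows "class_pmf A K = bind_pmf (pmf_of_set (choices (outer_doubles K n j) (outer_over K n j)))
     (\<lambda>X. map_pmf (\<lambda>Y. link_class A (K\<lparr>over := X \<union> Y\<rparr>))
        (pmf_of_set (choices (inner_doubles K n j) (inner_over K n j))))"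
    (is "_ = bind_pmf (pmf_of_set ?X) (\<lambda>X. map_pmf _ (pmf_of_set ?Y))")
    and "finite (choices (outer_doubles K n j) (outer_over K n j))"
    and "choices (outer_doubles K n j) (outer_over K n j) \<noteq> {}"
proof -
  note Y = inner_choices[OF assms, of n j]
  note split = choices_double_points[OF assms, of n j]
  show X: "finite ?X" "?X \<noteq> {}"
    using pseudo_diagramD(1)[OF assms] double_choices(2)[OF assms] split(1)
    by (auto intro!: finite_choices)
  have "pmf_of_set (choices (double_points K) (over K)) =
      map_pmf (\<lambda>(X, Y). X \<union> Y) (pmf_of_set (?X \<times> ?Y))"
    unfolding split(1) using X Y by (subst map_pmf_of_set_inj[OF split(2)]) auto
  also have "pmf_of_set (?X \<times> ?Y) = pair_pmf (pmf_of_set ?X) (pmf_of_set ?Y)"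
    using X Y by (rule pmf_of_set_Times)
  finally show "class_pmf A K = bind_pmf (pmf_of_set ?X)
     (\<lambda>X. map_pmf (\<lambda>Y. link_class A (K\<lparr>over := X \<union> Y\<rparr>)) (pmf_of_set ?Y))"
    by (simp add: class_pmf_def pair_pmf_def map_bind_pmf map_pmf_def bind_assoc_pmf
        bind_return_pmf)
qed

text \<open>The outer choices of \<open>K\<close> and \<open>K'\<close> are literally the same set,
  so the same \<open>X\<close> can be held fixed on both sides. All local moves are reduced to this
  comparison.\<close>

lemma class_pmf_local:
  assumes K: "pseudo_diagram A K" and K': "pseudo_diagram A K'"
    and l: "local_change A K K' \<phi> n j"
    and eq: "\<And>X. X \<in> choices (outer_doubles K n j) (outer_over K n j) \<Longrightarrow>
      map_pmf (\<lambda>Y. link_class A (K\<lparr>over := X \<union> Y\<rparr>))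
        (pmf_of_set (choices (inner_doubles K n j) (inner_over K n j))) =
      map_pmf (\<lambda>Y. link_class A (K'\<lparr>over := X \<union> Y\<rparr>))
        (pmf_of_set (choices (inner_doubles K' n j) (inner_over K' n j)))"
  shows "class_pmf A K = class_pmf A K'"
proof -
  have o: "outer_over K' n j = outer_over K n j" using l by (simp add: local_change_def)
  show ?thesis
    unfolding class_pmf_split(1)[OF K, of n j] class_pmf_split(1)[OF K', of n j]
      local_change_double_points[OF l] o
    using class_pmf_split(2,3)[OF K, of n j] eq by (intro bind_pmf_cong) simp_all
qed

text \<open>A fair coin replaces the pair, so that draws from two different two-element sets live on
  one sample space.\<close>

lemma map_pmf_of_set_pair:
  assumes "a \<noteq> b"
  shows "map_pmf f (pmf_of_set {a, b}) = map_pmf (\<lambda>x. if x then f a else f b) (pmf_of_set UNIV)"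
proof -
  have "inj (\<lambda>x. if x then a else b)" using assms by (auto simp: inj_on_def split: if_splits)
  then have "pmf_of_set ((\<lambda>x. if x then a else b) ` UNIV) =
      map_pmf (\<lambda>x. if x then a else b) (pmf_of_set UNIV)"
    by (intro map_pmf_of_set_inj[symmetric]) auto
  moreover have "(\<lambda>x. if x then a else b) ` UNIV = {a, b}" by (auto simp: UNIV_bool)
  ultimately show ?thesis by (simp add: pmf.map_comp o_def if_distrib)
qed

section \<open>Invariance under isotopy\<close>

text \<open>The reparametrisation carries crossings to crossings, and each resolution is moved by
  the same isotopy.\<close>

lemma isotopic_class_pmf:
  assumes "inner A \<subseteq> surface A" and K: "pseudo_diagram A K" and K': "pseudo_diagram A K'"
    and "isotopic A K K'"
  shows "class_pmf A K = class_pmf A K'"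
proof -
  obtain H \<rho> \<sigma> where
    H: "continuous_on ({0..1::real} \<times> surface A) (\<lambda>(r, x). H r x)"
      "\<forall>x \<in> surface A. H 0 x = x"
      "\<forall>r \<in> {0..1}. \<exists>G. homeomorphism (surface A) (surface A) (H r) G"
      "\<forall>r \<in> {0..1}. \<forall>k < nfixed A. H r ` fixed_curve A ` circle k = fixed_curve A ` circle k" and
    \<rho>: "homeomorphism (circles (comps K)) (circles (comps K')) \<rho> \<sigma>"
      "\<forall>k < nfixed A. \<rho> ` circle k = circle k" and
    c: "\<forall>u \<in> circles (comps K). curve K' (\<rho> u) = H 1 (curve K u)" and
    o: "over K' = map_prod \<rho> \<rho> ` over K"
    using assms(4) unfolding isotopic_def by (elim exE conjE) (rule that)
  let ?T = "circles (comps K)" and ?F = "map_prod \<rho> \<rho>"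
  let ?Ch = "choices (double_points K) (over K)"
  have im: "circles (comps K') = \<rho> ` ?T" using \<rho>(1) by (simp add: homeomorphism_def)
  have inj: "inj_on \<rho> ?T"
    using \<rho>(1) by (metis homeomorphism_apply1 inj_on_inverseI)
  obtain G where "homeomorphism (surface A) (surface A) (H 1) G" using H(3) by force
  \<comment> \<open>Injectivity of the final stage prevents new double points;
    \<open>inner A \<subseteq> surface A\<close> places the curve where it applies.\<close>
  then have injH: "inj_on (H 1) (surface A)" by (metis homeomorphism_apply1 inj_on_inverseI)
  have cK: "curve K u \<in> surface A" if "u \<in> ?T" for u
    using K assms(1) that by (auto simp: pseudo_diagram_def regular_diagram_def)
  have eq_iff: "curve K' (\<rho> s) = curve K' (\<rho> t) \<longleftrightarrow> curve K s = curve K t"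
    if "s \<in> ?T" "t \<in> ?T" for s t
    using c that inj_on_eq_iff[OF injH] cK by simp
  have dp: "double_points K' = ?F ` double_points K"
  proof
    show "?F ` double_points K \<subseteq> double_points K'"
      using eq_iff inj_on_eq_iff[OF inj] by (auto simp: double_points_def im)
    show "double_points K' \<subseteq> ?F ` double_points K"
    proof (rule subrelI)
      fix a b assume ab: "(a, b) \<in> double_points K'"
      then obtain s t where st: "s \<in> ?T" "t \<in> ?T" "a = \<rho> s" "b = \<rho> t"
        by (auto simp: double_points_def im)
      then have "(s, t) \<in> double_points K"
        using ab eq_iff by (auto simp: double_points_def)
      then show "(a, b) \<in> ?F ` double_points K" using st by force
    qed
  qed
  have sub: "double_points K \<subseteq> ?T \<times> ?T" by (auto simp: double_points_def)
  have injF: "inj_on ?F (double_points K)"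
    using map_prod_inj_on[OF inj inj] sub by (rule inj_on_subset)
  have ch: "choices (double_points K') (over K') = image ?F ` ?Ch"
    unfolding dp o
    by (rule choices_image[OF injF pseudo_diagramD(2)[OF K] sym_double_points]) simp
  have "inj_on (image ?F) ?Ch"
    by (rule inj_on_subset[OF inj_on_image_Pow[OF injF]]) (auto dest: choicesD)
  then have "pmf_of_set (image ?F ` ?Ch) = map_pmf (image ?F) (pmf_of_set ?Ch)"
    using double_choices[OF K] by (simp add: map_pmf_of_set_inj)
  then have "class_pmf A K' =
      map_pmf (\<lambda>X. link_class A (K'\<lparr>over := ?F ` X\<rparr>)) (pmf_of_set ?Ch)"
    unfolding class_pmf_def ch by (simp add: pmf.map_comp o_def)
  moreover have "link_class A (K\<lparr>over := X\<rparr>) = link_class A (K'\<lparr>over := ?F ` X\<rparr>)"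
    if X: "X \<in> ?Ch" for X
  proof (rule link_step_class)
    have "isotopic A (K\<lparr>over := X\<rparr>) (K'\<lparr>over := ?F ` X\<rparr>)"
      unfolding isotopic_def using H \<rho> c
      by (intro exI[of _ H] exI[of _ \<rho>] exI[of _ \<sigma>]) simp
    then show "link_step A (K\<lparr>over := X\<rparr>) (K'\<lparr>over := ?F ` X\<rparr>)"
      using link_diagram_choice[OF K X] link_diagram_choice[OF K', of "?F ` X"] X
      by (simp add: link_step_def ch)
  qed
  ultimately show ?thesis
    unfolding class_pmf_def[of A K]
    using double_choices[OF K] by (simp only:, intro map_pmf_cong) simp_all
qed

section \<open>Invariance under the moves on one crossing and on two classical crossings\<close>

lemma inner_choices_classical:
  assumes K: "pseudo_diagram A K"
    and cl: "\<And>s t. (s, t) \<in> inner_doubles K n j \<Longrightarrow> (s, t) \<in> over K \<or> (t, s) \<in> over K"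
  shows "choices (inner_doubles K n j) (inner_over K n j) = {inner_over K n j}"
proof (rule choices_total)
  show "inner_over K n j \<subseteq> inner_doubles K n j"
    using pseudo_diagramD(2)[OF K] by (auto simp: inner_doubles_def)
  show "(s, t) \<in> inner_over K n j \<longleftrightarrow> (t, s) \<notin> inner_over K n j"
    if st: "(s, t) \<in> inner_doubles K n j" for s t
    using cl[OF st] pseudo_diagramD(3)[OF K, of s t] st by (auto simp: inner_doubles_def)
qed

lemma outer_inner_Diff:
  assumes "X \<in> choices (outer_doubles K n j) (outer_over K n j)"
    and "Y \<in> choices (inner_doubles K' n j) (inner_over K' n j)"
  shows "(X \<union> Y) - strands n j \<times> strands n j = X"
  using choicesD(2)[OF assms(1)] choicesD(2)[OF assms(2)] by (auto simp: inner_doubles_def)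

lemma local_change_choices:
  assumes l: "local_change A K K' \<phi> n j"
    and X: "X \<in> choices (outer_doubles K n j) (outer_over K n j)"
    and Y: "Y \<in> choices (inner_doubles K n j) (inner_over K n j)"
    and Y': "Y' \<in> choices (inner_doubles K' n j) (inner_over K' n j)"
  shows "local_change A (K\<lparr>over := X \<union> Y\<rparr>) (K'\<lparr>over := X \<union> Y'\<rparr>) \<phi> n j"
  using outer_inner_Diff[OF X Y] outer_inner_Diff[OF X Y']
  by (intro local_change_over_update[OF l]) simp

text \<open>Both resolutions share \<open>X\<close> outside and are link diagrams, so a classical
  move between them is a link step.\<close>

lemma local_change_link_class:
  assumes K: "pseudo_diagram A K" and K': "pseudo_diagram A K'"
    and l: "local_change A K K' \<phi> n j"
    and X: "X \<in> choices (outer_doubles K n j) (outer_over K n j)"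
    and Y: "Y \<in> choices (inner_doubles K n j) (inner_over K n j)"
    and Y': "Y' \<in> choices (inner_doubles K' n j) (inner_over K' n j)"
    and R: "R1 A (K\<lparr>over := X \<union> Y\<rparr>) (K'\<lparr>over := X \<union> Y'\<rparr>) \<or>
      R2 A (K\<lparr>over := X \<union> Y\<rparr>) (K'\<lparr>over := X \<union> Y'\<rparr>) \<or>
      R3 A (K\<lparr>over := X \<union> Y\<rparr>) (K'\<lparr>over := X \<union> Y'\<rparr>)"
  shows "link_class A (K\<lparr>over := X \<union> Y\<rparr>) = link_class A (K'\<lparr>over := X \<union> Y'\<rparr>)"
proof (rule link_step_class)
  have "X \<in> choices (outer_doubles K' n j) (outer_over K' n j)"
    using X l local_change_double_points[OF l] by (simp add: local_change_def)
  then show "link_step A (K\<lparr>over := X \<union> Y\<rparr>) (K'\<lparr>over := X \<union> Y'\<rparr>)"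
    using link_diagram_outer_inner[OF K X Y] link_diagram_outer_inner[OF K' _ Y'] R
    by (auto simp: link_step_def)
qed

text \<open>Whichever strand of the kink is over, \<open>R1\<close> removes it, so the class is
  constant over the inner choices. This covers \<open>R1\<close> and \<open>PR1\<close>
  together.\<close>

lemma kink_removal_class_pmf:
  assumes K: "pseudo_diagram A K" and K': "pseudo_diagram A K'"
    and "kink_removal A K K' s t"
  shows "class_pmf A K = class_pmf A K'"
proof -
  obtain \<phi> j where l: "local_change A K K' \<phi> 1 j"
    and d: "inner_doubles K 1 j = {(s, t), (t, s)}" and d': "inner_doubles K' 1 j = {}"
    using assms(3) unfolding kink_removal_def by blast
  show ?thesis
  proof (rule class_pmf_local[OF K K' l])
    fix X assume X: "X \<in> choices (outer_doubles K 1 j) (outer_over K 1 j)"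
    have ch': "choices (inner_doubles K' 1 j) (inner_over K' 1 j) = {{}}"
      using inner_choices(2)[OF K', of 1 j] d' choicesD(2) by fastforce
    have "link_class A (K\<lparr>over := X \<union> Y\<rparr>) = link_class A (K'\<lparr>over := X \<union> {}\<rparr>)"
      if Y: "Y \<in> choices (inner_doubles K 1 j) (inner_over K 1 j)" for Y
    proof (rule local_change_link_class[OF K K' l X Y])
      show Y': "{} \<in> choices (inner_doubles K' 1 j) (inner_over K' 1 j)"
        unfolding ch' by simp
      note l' = local_change_choices[OF l X Y Y']
      \<comment> \<open>Both labellings are provided because \<open>R1\<close> asks for the first
        named parameter to be the upper one.\<close>
      have "kink_removal A (K\<lparr>over := X \<union> Y\<rparr>) (K'\<lparr>over := X \<union> {}\<rparr>) s t"
        "kink_removal A (K\<lparr>over := X \<union> Y\<rparr>) (K'\<lparr>over := X \<union> {}\<rparr>) t s"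
        unfolding kink_removal_def using l' d d' by (auto simp: insert_commute)
      moreover have "(s, t) \<in> Y \<or> (t, s) \<in> Y"
        using choicesD(3)[OF Y, of s t] d by auto
      moreover have "Y \<subseteq> over (K\<lparr>over := X \<union> Y\<rparr>)" by simp
      ultimately have "R1 A (K\<lparr>over := X \<union> Y\<rparr>) (K'\<lparr>over := X \<union> {}\<rparr>)"
        unfolding R1_def by (meson subsetD)
      then show "R1 A (K\<lparr>over := X \<union> Y\<rparr>) (K'\<lparr>over := X \<union> {}\<rparr>) \<or>
        R2 A (K\<lparr>over := X \<union> Y\<rparr>) (K'\<lparr>over := X \<union> {}\<rparr>) \<or>
        R3 A (K\<lparr>over := X \<union> Y\<rparr>) (K'\<lparr>over := X \<union> {}\<rparr>)" by blast
    qed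
    then have "map_pmf (\<lambda>Y. link_class A (K\<lparr>over := X \<union> Y\<rparr>))
        (pmf_of_set (choices (inner_doubles K 1 j) (inner_over K 1 j))) =
      map_pmf (\<lambda>_. link_class A (K'\<lparr>over := X \<union> {}\<rparr>))
        (pmf_of_set (choices (inner_doubles K 1 j) (inner_over K 1 j)))"
      using inner_choices[OF K, of 1 j] by (intro map_pmf_cong) auto
    then show "map_pmf (\<lambda>Y. link_class A (K\<lparr>over := X \<union> Y\<rparr>))
        (pmf_of_set (choices (inner_doubles K 1 j) (inner_over K 1 j))) =
      map_pmf (\<lambda>Y. link_class A (K'\<lparr>over := X \<union> Y\<rparr>))
        (pmf_of_set (choices (inner_doubles K' 1 j) (inner_over K' 1 j)))"
      unfolding ch' by (simp add: pmf_of_set_singleton map_pmf_const)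
  qed
qed

text \<open>Both crossings are classical and none remains afterwards, so each side has a single
  inner choice and the move persists in every resolution.\<close>

lemma R2_class_pmf:
  assumes K: "pseudo_diagram A K" and K': "pseudo_diagram A K'" and "R2 A K K'"
  shows "class_pmf A K = class_pmf A K'"
proof -
  obtain \<phi> j s t s' t' where l: "local_change A K K' \<phi> 2 j" and b: "bigon K j s t s' t'"
    and o: "(s, t) \<in> over K" "(s', t') \<in> over K" and d': "inner_doubles K' 2 j = {}"
    using assms(3) unfolding R2_def by blast
  have d: "inner_doubles K 2 j = {(s, t), (t, s), (s', t'), (t', s')}"
    using b by (simp add: bigon_def)
  show ?thesis
  proof (rule class_pmf_local[OF K K' l])
    fix X assume X: "X \<in> choices (outer_doubles K 2 j) (outer_over K 2 j)"
    let ?Y = "inner_over K 2 j" and ?Y' = "inner_over K' 2 j"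
    have ch: "choices (inner_doubles K 2 j) ?Y = {?Y}"
      using o d by (intro inner_choices_classical[OF K]) auto
    have ch': "choices (inner_doubles K' 2 j) ?Y' = {?Y'}"
      using d' by (intro inner_choices_classical[OF K']) auto
    have Y: "?Y \<in> choices (inner_doubles K 2 j) ?Y" "?Y' \<in> choices (inner_doubles K' 2 j) ?Y'"
      by (simp_all add: ch ch')
    have "(s, t) \<in> strands 2 j \<times> strands 2 j" "(s', t') \<in> strands 2 j \<times> strands 2 j"
      using d by (auto simp: inner_doubles_def)
    then have "R2 A (K\<lparr>over := X \<union> ?Y\<rparr>) (K'\<lparr>over := X \<union> ?Y'\<rparr>)"
      unfolding R2_def using local_change_choices[OF l X Y] b o d'
      by (intro exI[of _ \<phi>] exI[of _ j] exI[of _ s] exI[of _ t] exI[of _ s'] exI[of _ t'])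
        (simp add: bigon_def)
    then have "link_class A (K\<lparr>over := X \<union> ?Y\<rparr>) = link_class A (K'\<lparr>over := X \<union> ?Y'\<rparr>)"
      by (intro local_change_link_class[OF K K' l X Y]) blast
    then show "map_pmf (\<lambda>Y. link_class A (K\<lparr>over := X \<union> Y\<rparr>))
        (pmf_of_set (choices (inner_doubles K 2 j) ?Y)) =
      map_pmf (\<lambda>Y. link_class A (K'\<lparr>over := X \<union> Y\<rparr>))
        (pmf_of_set (choices (inner_doubles K' 2 j) ?Y'))"
      by (simp add: ch ch' pmf_of_set_singleton)
  qed
qed

section \<open>Invariance under the triangle moves\<close>

lemma strands_permute:
  assumes "\<pi> ` {..<n} = {..<n}"
  shows "strands n (\<lambda>i. j (\<pi> i)) = strands n j"
proof -
  have "strands n j = (\<Union>i \<in> \<pi> ` {..<n}. j i ` {0..1})" by (simp add: strands_def assms)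
  then show ?thesis by (simp add: strands_def)
qed

lemma tangle_permute:
  assumes t: "tangle A K \<phi> n j" and \<pi>: "bij_betw \<pi> {..<n} {..<n}"
  shows "tangle A K \<phi> n (\<lambda>i. j (\<pi> i))"
proof -
  have lt: "\<pi> i < n" if "i < n" for i using \<pi> that by (auto simp: bij_betw_def)
  have "inj_on ((\<lambda>(i, x). j i x) \<circ> map_prod \<pi> id) ({..<n} \<times> {0..1})"
  proof (rule comp_inj_on)
    show "inj_on (map_prod \<pi> id) ({..<n} \<times> {0..1})"
      using \<pi> by (intro map_prod_inj_on) (auto simp: bij_betw_def)
    have "map_prod \<pi> id ` ({..<n} \<times> {0..1}) = {..<n} \<times> {0..1 :: real}"
      using \<pi> by (intro map_prod_surj_on) (simp_all add: bij_betw_def)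
    then show "inj_on (\<lambda>(i, x). j i x) (map_prod \<pi> id ` ({..<n} \<times> {0..1}))"
      using t by (simp add: tangle_def)
  qed
  moreover have "(\<lambda>(i, x). j i x) \<circ> map_prod \<pi> id = (\<lambda>(i, x). j (\<pi> i) x)" by auto
  ultimately show ?thesis
    using t lt strands_permute[of \<pi> n j] \<pi> by (simp add: tangle_def bij_betw_def)
qed

text \<open>Arc numbers are only labels. Renumbering is needed because \<open>R3\<close> numbers the
  arcs from top to bottom, while a random choice may put them in another order.\<close>

lemma local_change_permute:
  assumes "local_change A K K' \<phi> n j" and \<pi>: "bij_betw \<pi> {..<n} {..<n}"
  shows "local_change A K K' \<phi> n (\<lambda>i. j (\<pi> i))"
proof -
  have "\<pi> i < n" if "i < n" for i using \<pi> that by (auto simp: bij_betw_def)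
  then show ?thesis
    using assms(1) strands_permute[of \<pi> n j] \<pi> unfolding local_change_def
    by (simp add: tangle_permute[OF _ \<pi>] bij_betw_def)
qed

section \<open>Triangles as orientations of pairs of arcs\<close>

abbreviation arc_pairs :: "(nat \<times> nat) set" where
  "arc_pairs \<equiv> {(i, i'). i < 3 \<and> i' < 3 \<and> i \<noteq> i'}"

text \<open>It translates "arc \<open>i\<close> is over arc \<open>i'\<close>" into parameters, so
  that orienting the crossings becomes orienting \<open>arc_pairs\<close>, the same set before and
  after a move.\<close>

definition crossing :: "(nat \<Rightarrow> real \<Rightarrow> param) \<Rightarrow> (nat \<Rightarrow> nat \<Rightarrow> real) \<Rightarrow> nat \<times> nat \<Rightarrow> param \<times> param"
  where "crossing j c = (\<lambda>(i, i'). (j i (c i i'), j i' (c i' i)))"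

lemma triangle_crossing:
  "triangle K j c W \<longleftrightarrow> (\<forall>i<3. \<forall>i'<3. i \<noteq> i' \<longrightarrow> c i i' \<in> {0..1}) \<and>
     inner_doubles K 3 j = crossing j c ` arc_pairs \<and> inner_over K 3 j = crossing j c ` W"
proof -
  have "{(j i (c i i'), j i' (c i' i)) | i i'. i < 3 \<and> i' < 3 \<and> i \<noteq> i'} = crossing j c ` arc_pairs"
    "{(j i (c i i'), j i' (c i' i)) | i i'. (i, i') \<in> W} = crossing j c ` W"
    by (force simp: crossing_def)+
  then show ?thesis by (simp only: triangle_def)
qed

text \<open>Different arcs have disjoint parameters, so the numbers of both arcs can be read off
  from the crossing.\<close>

lemma inj_crossing:
  assumes t: "tangle A K \<phi> 3 j" and c: "\<forall>i<3. \<forall>i'<3. i \<noteq> i' \<longrightarrow> c i i' \<in> {0..1}"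
  shows "inj_on (crossing j c) arc_pairs"
proof (rule inj_onI, clarify)
  have inj: "i = k" if "j i x = j k y" "i < 3" "k < 3" "x \<in> {0..1}" "y \<in> {0..1}" for i k x y
    using inj_onD[of "\<lambda>(i, x). j i x" "{..<3} \<times> {0..1}" "(i, x)" "(k, y)"] t that
    by (simp add: tangle_def)
  fix i i' k k' :: nat
  assume "i < 3" "i' < 3" "i \<noteq> i'" "k < 3" "k' < 3" "k \<noteq> k'"
    "crossing j c (i, i') = crossing j c (k, k')"
  then show "i = k \<and> i' = k'"
    using c inj[of i "c i i'" k "c k k'"] inj[of i' "c i' i" k' "c k' k"]
    by (simp add: crossing_def)
qed

text \<open>Renumbering \<open>j\<close>, \<open>c\<close> and \<open>c'\<close> by
  \<open>\<pi>\<close> pulls the over-relation back to \<open>V\<close>; the order condition ranges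
  over all triples of arcs and is unaffected.\<close>

lemma triangle_move_permute:
  assumes "triangle_move (map_prod \<pi> \<pi> ` V) A K K'" and \<pi>: "bij_betw \<pi> {..<3 :: nat} {..<3}"
  shows "triangle_move V A K K'"
proof -
  obtain \<phi> j c c' where l: "local_change A K K' \<phi> 3 j"
    and t: "triangle K j c (map_prod \<pi> \<pi> ` V)" "triangle K' j c' (map_prod \<pi> \<pi> ` V)"
    and o: "\<forall>i<3. \<forall>i'<3. \<forall>i''<3. i \<noteq> i' \<and> i \<noteq> i'' \<and> i' \<noteq> i'' \<longrightarrow>
        (c i i' < c i i'' \<longleftrightarrow> c' i i'' < c' i i')"
    using assms(1) unfolding triangle_move_def by blast
  have lt: "\<pi> i < 3" if "i < 3" for i using \<pi> that by (auto simp: bij_betw_def)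
  have neq: "\<pi> i \<noteq> \<pi> k" if "i < 3" "k < 3" "i \<noteq> k" for i k
    using \<pi> that by (auto simp: bij_betw_def dest: inj_onD)
  \<comment> \<open>An injective map of a finite set into itself is onto, here seen by
    counting.\<close>
  have ap: "map_prod \<pi> \<pi> ` arc_pairs = arc_pairs"
  proof (rule card_subset_eq)
    have fin: "finite arc_pairs" by (rule finite_subset[of _ "{..<3} \<times> {..<3}"]) auto
    then show "finite arc_pairs" .
    show "map_prod \<pi> \<pi> ` arc_pairs \<subseteq> arc_pairs" using lt neq by auto
    have "inj_on (map_prod \<pi> \<pi>) ({..<3} \<times> {..<3})"
      using \<pi> by (intro map_prod_inj_on) (auto simp: bij_betw_def)
    then have "inj_on (map_prod \<pi> \<pi>) arc_pairs" by (rule inj_on_subset) auto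
    then show "card (map_prod \<pi> \<pi> ` arc_pairs) = card arc_pairs" by (rule card_image)
  qed
  have cr: "crossing j c ` map_prod \<pi> \<pi> ` U = crossing (\<lambda>i. j (\<pi> i)) (\<lambda>i i'. c (\<pi> i) (\<pi> i')) ` U"
    for c U by (force simp: crossing_def image_image)
  have "triangle K (\<lambda>i. j (\<pi> i)) (\<lambda>i i'. c (\<pi> i) (\<pi> i')) V"
    if "triangle K j c (map_prod \<pi> \<pi> ` V)" for K c
    using that strands_permute[of \<pi> 3 j] \<pi> lt neq cr[of c V] cr[of c arc_pairs]
    by (simp add: triangle_crossing inner_doubles_def ap bij_betw_def)
  note t' = this[OF t(1)] this[OF t(2)]
  have "\<forall>i<3. \<forall>i'<3. \<forall>i''<3. i \<noteq> i' \<and> i \<noteq> i'' \<and> i' \<noteq> i'' \<longrightarrow>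
      (c (\<pi> i) (\<pi> i') < c (\<pi> i) (\<pi> i'') \<longleftrightarrow> c' (\<pi> i) (\<pi> i'') < c' (\<pi> i) (\<pi> i'))"
    using o lt neq by simp
  with t' local_change_permute[OF l \<pi>] show ?thesis
    unfolding triangle_move_def by blast
qed

text \<open>The same abstract orientation \<open>V\<close> is imposed on both triangles. The
  assumption \<open>acyc\<close> excludes cyclic orientations, in which no arc is on top and
  \<open>R3\<close> does not apply.\<close>

lemma triangle_move_class_pmf:
  assumes K: "pseudo_diagram A K" and K': "pseudo_diagram A K'"
    and "triangle_move W A K K'" and "W \<subseteq> arc_pairs"
    and acyc: "\<And>V. V \<in> choices arc_pairs W \<Longrightarrow>
      \<exists>\<pi>. bij_betw \<pi> {..<3 :: nat} {..<3} \<and> V = map_prod \<pi> \<pi> ` {(0, 1), (0, 2), (1, 2)}"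
  shows "class_pmf A K = class_pmf A K'"
proof -
  obtain \<phi> j c c' where l: "local_change A K K' \<phi> 3 j"
    and t: "triangle K j c W" "triangle K' j c' W"
    and o: "\<forall>i<3. \<forall>i'<3. \<forall>i''<3. i \<noteq> i' \<and> i \<noteq> i'' \<and> i' \<noteq> i'' \<longrightarrow>
        (c i i' < c i i'' \<longleftrightarrow> c' i i'' < c' i i')"
    using assms(3) unfolding triangle_move_def by blast
  have sym: "sym arc_pairs" by (auto simp: sym_def)
  have tangle: "tangle A K \<phi> 3 j" "tangle A K' \<phi> 3 j" using l by (simp_all add: local_change_def)
  have ch: "choices (inner_doubles K 3 j) (inner_over K 3 j) = image (crossing j c) ` choices arc_pairs W"
    and inj: "inj_on (image (crossing j c)) (choices arc_pairs W)"
    if t: "triangle K j c W" and "tangle A K \<phi> 3 j" for K c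
  proof -
    have inj: "inj_on (crossing j c) arc_pairs"
      using t by (intro inj_crossing[OF \<open>tangle A K \<phi> 3 j\<close>]) (simp add: triangle_crossing)
    show "choices (inner_doubles K 3 j) (inner_over K 3 j) = image (crossing j c) ` choices arc_pairs W"
      using t choices_image[OF inj \<open>W \<subseteq> arc_pairs\<close> sym]
      by (simp add: triangle_crossing crossing_def)
    show "inj_on (image (crossing j c)) (choices arc_pairs W)"
      by (rule inj_on_subset[OF inj_on_image_Pow[OF inj]]) (auto dest: choicesD)
  qed
  note chK = ch[OF t(1) tangle(1)] ch[OF t(2) tangle(2)]
  note injK = inj[OF t(1) tangle(1)] inj[OF t(2) tangle(2)]
  have fin: "finite (choices arc_pairs W)"
    by (rule finite_choices, rule finite_subset[of _ "{..<3} \<times> {..<3}"]) auto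
  have ne: "choices arc_pairs W \<noteq> {}" using inner_choices(2)[OF K, of 3 j] by (simp add: chK)
  show ?thesis
  proof (rule class_pmf_local[OF K K' l])
    fix X assume X: "X \<in> choices (outer_doubles K 3 j) (outer_over K 3 j)"
    have *: "link_class A (K\<lparr>over := X \<union> crossing j c ` V\<rparr>) =
        link_class A (K'\<lparr>over := X \<union> crossing j c' ` V\<rparr>)" if V: "V \<in> choices arc_pairs W" for V
    proof (rule local_change_link_class[OF K K' l X])
      show Y: "crossing j c ` V \<in> choices (inner_doubles K 3 j) (inner_over K 3 j)"
        "crossing j c' ` V \<in> choices (inner_doubles K' 3 j) (inner_over K' 3 j)"
        using V by (simp_all add: chK)
      have X': "X \<inter> strands 3 j \<times> strands 3 j = {}" using choicesD(2)[OF X] by auto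
      have "triangle (K\<lparr>over := X \<union> crossing j c ` V\<rparr>) j c V"
        if t: "triangle K j c W" and "crossing j c ` V \<in> choices (inner_doubles K 3 j) (inner_over K 3 j)"
        for K :: "'a diagram" and c
      proof -
        have "crossing j c ` V \<subseteq> strands 3 j \<times> strands 3 j"
          using choicesD(2)[OF that(2)] by (auto simp: inner_doubles_def)
        then have "(X \<union> crossing j c ` V) \<inter> strands 3 j \<times> strands 3 j = crossing j c ` V"
          using X' by blast
        then show ?thesis using t by (simp add: triangle_crossing)
      qed
      note t' = this[OF t(1) Y(1)] this[OF t(2) Y(2)]
      have "triangle_move V A (K\<lparr>over := X \<union> crossing j c ` V\<rparr>) (K'\<lparr>over := X \<union> crossing j c' ` V\<rparr>)"
        unfolding triangle_move_def using t' local_change_choices[OF l X Y] o by blast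
      then have "R3 A (K\<lparr>over := X \<union> crossing j c ` V\<rparr>) (K'\<lparr>over := X \<union> crossing j c' ` V\<rparr>)"
        using acyc[OF V] triangle_move_permute unfolding R3_def by metis
      then show "R1 A (K\<lparr>over := X \<union> crossing j c ` V\<rparr>) (K'\<lparr>over := X \<union> crossing j c' ` V\<rparr>) \<or>
        R2 A (K\<lparr>over := X \<union> crossing j c ` V\<rparr>) (K'\<lparr>over := X \<union> crossing j c' ` V\<rparr>) \<or>
        R3 A (K\<lparr>over := X \<union> crossing j c ` V\<rparr>) (K'\<lparr>over := X \<union> crossing j c' ` V\<rparr>)" by blast
    qed
    have "map_pmf (\<lambda>V. link_class A (K\<lparr>over := X \<union> crossing j c ` V\<rparr>))
          (pmf_of_set (choices arc_pairs W)) =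
        map_pmf (\<lambda>V. link_class A (K'\<lparr>over := X \<union> crossing j c' ` V\<rparr>))
          (pmf_of_set (choices arc_pairs W))"
      using fin ne * by (intro map_pmf_cong) simp_all
    then show "map_pmf (\<lambda>Y. link_class A (K\<lparr>over := X \<union> Y\<rparr>))
        (pmf_of_set (choices (inner_doubles K 3 j) (inner_over K 3 j))) =
      map_pmf (\<lambda>Y. link_class A (K'\<lparr>over := X \<union> Y\<rparr>))
        (pmf_of_set (choices (inner_doubles K' 3 j) (inner_over K' 3 j)))"
      \<comment> \<open>Both uniform laws are pulled back to the uniform law on
        \<open>choices arc_pairs W\<close>.\<close>
      unfolding chK map_pmf_of_set_inj[OF injK(1) ne fin, symmetric]
        map_pmf_of_set_inj[OF injK(2) ne fin, symmetric]
      by (simp add: pmf.map_comp o_def)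
  qed
qed

text \<open>In each \<open>W\<close> arc 0 is above both others or below both others, whereas in a
  3-cycle every arc is over exactly one other. The pair of arcs 1 and 2 then decides between two
  linear orders.\<close>

lemma linear_order_choice:
  assumes V: "V \<in> choices arc_pairs W"
    and W: "W = {(0, 1), (0, 2), (1, 2)} \<or> W = {(0, 1), (0, 2)} \<or> W = {(1, 0), (2, 0)}"
  shows "\<exists>\<pi>. bij_betw \<pi> {..<3 :: nat} {..<3} \<and> V = map_prod \<pi> \<pi> ` {(0, 1), (0, 2), (1, 2)}"
proof -
  have ex: ?thesis if V: "V = {(a, b), (a, c), (b, c)}" and abc: "{a, b, c} = {..<3}" for a b c
  proof (intro exI conjI)
    \<comment> \<open>\<open>\<pi>\<close> sends a height to the arc at that height:
      \<open>a\<close> on top, then \<open>b\<close>, then \<open>c\<close>.\<close>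
    define \<pi> where "\<pi> = (\<lambda>i :: nat. if i = 0 then a else if i = 1 then b else c)"
    have "{..<3} = {0, 1, 2 :: nat}" by auto
    then have "\<pi> ` {..<3} = {a, b, c}" by (simp add: \<pi>_def insert_commute)
    then have "\<pi> ` {..<3} = {..<3}" using abc by simp
    then show "bij_betw \<pi> {..<3} {..<3}" by (simp add: bij_betw_def eq_card_imp_inj_on)
    show "V = map_prod \<pi> \<pi> ` {(0, 1), (0, 2), (1, 2)}" by (simp add: V \<pi>_def)
  qed
  have lt3: "{..<3} = {0, 1, 2 :: nat}" by auto
  have sub: "V \<subseteq> {(0, 1), (1, 0), (0, 2), (2, 0), (1, 2), (2, 1)}"
  proof -
    have "i = 0 \<or> i = 1 \<or> i = 2" if "i < 3" for i :: nat using that by linarith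
    then have "p \<in> {(0, 1), (1, 0), (0, 2), (2, 0), (1, 2), (2, 1)}" if "p \<in> arc_pairs" for p
      using that by (cases p) (smt (verit, best) case_prodD insertCI mem_Collect_eq)
    then have "arc_pairs \<subseteq> {(0, 1), (1, 0), (0, 2), (2, 0), (1, 2), (2, 1)}" by (rule subsetI)
    with choicesD(2)[OF V] show ?thesis by (rule subset_trans)
  qed
  have anti: "(0, 1) \<in> V \<longleftrightarrow> (1, 0) \<notin> V" "(0, 2) \<in> V \<longleftrightarrow> (2, 0) \<notin> V"
    "(1, 2) \<in> V \<longleftrightarrow> (2, 1) \<notin> V"
    by (rule choicesD(3)[OF V]; simp)+
  consider "(0, 1) \<in> V" "(0, 2) \<in> V" | "(1, 0) \<in> V" "(2, 0) \<in> V"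
    using W choicesD(1)[OF V] by auto
  then show ?thesis
  proof cases
    case 1
    show ?thesis
    proof (cases "(1, 2) \<in> V")
      case True
      then have "V = {(0, 1), (0, 2), (1, 2)}" using 1 sub anti by blast
      then show ?thesis by (rule ex) (auto simp: lt3)
    next
      case False
      then have "V = {(0, 2), (0, 1), (2, 1)}" using 1 sub anti by blast
      then show ?thesis by (rule ex) (auto simp: lt3)
    qed
  next
    case 2
    show ?thesis
    proof (cases "(1, 2) \<in> V")
      case True
      then have "V = {(1, 2), (1, 0), (2, 0)}" using 2 sub anti by blast
      then show ?thesis by (rule ex) (auto simp: lt3)
    next
      case False
      then have "V = {(2, 1), (2, 0), (1, 0)}" using 2 sub anti by blast
      then show ?thesis by (rule ex) (auto simp: lt3)
    qed
  qed
qed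

lemma R3_PR3_class_pmf:
  assumes "pseudo_diagram A K" "pseudo_diagram A K'" "R3 A K K' \<or> PR3 A K K' \<or> PR3' A K K'"
  shows "class_pmf A K = class_pmf A K'"
proof -
  obtain W where "triangle_move W A K K'"
    and "W = {(0, 1), (0, 2), (1, 2)} \<or> W = {(0, 1), (0, 2)} \<or> W = {(1, 0), (2, 0)}"
    using assms(3) unfolding R3_def PR3_def PR3'_def by blast
  then show ?thesis
    using assms(1,2) linear_order_choice by (intro triangle_move_class_pmf[of A K K' W]) auto
qed

section \<open>Redrawing the arcs in a disc\<close>

lemma compact_circles: "compact (circles n)"
  unfolding circles_def by (intro compact_Times finite_imp_compact compact_sphere) simp

text \<open>Openness of the smaller image follows from compactness: by injectivity it is the larger
  open image minus the image of the compact set \<open>?C\<close>, which is closed.\<close>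

lemma disc_chart_shrink:
  assumes \<phi>: "disc_chart A \<phi>" and \<epsilon>: "0 < \<epsilon>" "\<epsilon> \<le> 1"
  shows "disc_chart A (\<lambda>z. \<phi> (of_real \<epsilon> * z))"
proof -
  let ?m = "\<lambda>z :: complex. of_real \<epsilon> * z"
  have *: "norm (?m z) \<le> norm z" for z
    using \<epsilon> by (simp add: norm_mult mult_left_le_one_le)
  then have sub: "?m ` cball 0 1 \<subseteq> cball 0 1" "?m ` ball 0 1 \<subseteq> ball 0 1"
    using order_trans[OF *] le_less_trans[OF *] by (auto simp del: norm_mult)
  have cont: "continuous_on (cball 0 1) \<phi>" and inj: "inj_on \<phi> (cball 0 1)"
    and im: "\<phi> ` cball 0 1 \<subseteq> inner A" and op: "openin (top_of_set (surface A)) (\<phi> ` ball 0 1)"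
    using \<phi> by (simp_all add: disc_chart_def)
  have "continuous_on (cball 0 1) (\<phi> \<circ> ?m)"
    using sub(1) by (intro continuous_on_compose continuous_on_subset[OF cont] continuous_intros)
  moreover have "inj_on (\<phi> \<circ> ?m) (cball 0 1)"
    using sub(1) \<epsilon> by (intro comp_inj_on inj_on_subset[OF inj]) (auto simp: inj_on_def)
  moreover have "(\<phi> \<circ> ?m) ` cball 0 1 \<subseteq> inner A" using sub(1) im by auto
  moreover have "openin (top_of_set (surface A)) ((\<phi> \<circ> ?m) ` ball 0 1)"
  proof -
    let ?C = "cball 0 1 - ?m ` ball 0 1"
    have "open (?m ` ball 0 1)"
      using open_scaling[of \<epsilon> "ball (0 :: complex) 1"] \<epsilon>(1) by (simp add: scaleR_conv_of_real)
    then have "compact ?C" by (simp add: compact_diff)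
    then have "compact (\<phi> ` ?C)"
      by (intro compact_continuous_image continuous_on_subset[OF cont]) auto
    then have "openin (top_of_set (surface A)) (\<phi> ` ball 0 1 \<inter> - (\<phi> ` ?C))"
      by (intro openin_Int_open op open_Compl compact_imp_closed)
    moreover have "\<phi> ` ball 0 1 \<inter> - (\<phi> ` ?C) = \<phi> ` ?m ` ball 0 1"
    proof (intro equalityI subsetI)
      fix x assume "x \<in> \<phi> ` ?m ` ball 0 1"
      then obtain z where z: "z \<in> ?m ` ball 0 1" "x = \<phi> z" by blast
      then have "x \<notin> \<phi> ` ?C"
        using inj_on_eq_iff[OF inj, of z] sub(2) ball_subset_cball[of 0 1] by fastforce
      then show "x \<in> \<phi> ` ball 0 1 \<inter> - (\<phi> ` ?C)" using z sub(2) by blast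
    next
      fix x assume "x \<in> \<phi> ` ball 0 1 \<inter> - (\<phi> ` ?C)"
      then show "x \<in> \<phi> ` ?m ` ball 0 1" using ball_subset_cball[of "0 :: complex" 1] by blast
    qed
    ultimately show ?thesis by (simp add: image_comp)
  qed
  ultimately show ?thesis by (simp add: disc_chart_def o_def)
qed

text \<open>The chart of a double point outside the compact set \<open>C\<close> can be shrunk until it avoids
  \<open>C\<close>, so a change of the diagram within \<open>C\<close> does not affect transversality there.\<close>

lemma transverse_outside:
  assumes A: "inner A \<subseteq> surface A"
    and cont: "continuous_on (circles (comps K)) (curve K)"
    and im: "curve K ` circles (comps K) \<subseteq> inner A"
    and tr: "transverse A K s t" and st: "(s, t) \<in> double_points K"
    and C: "compact C" "curve K s \<notin> C"
    and comps: "comps K' = comps K"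
    and out: "\<And>u. u \<in> circles (comps K) \<Longrightarrow> curve K u \<notin> C \<Longrightarrow> curve K' u = curve K u"
    and ins: "\<And>u. u \<in> circles (comps K) \<Longrightarrow> curve K u \<in> C \<Longrightarrow> curve K' u \<in> C"
  shows "transverse A K' s t"
proof -
  let ?T = "circles (comps K)"
  obtain \<phi> U V where ch: "disc_chart A \<phi>" and \<phi>0: "\<phi> 0 = curve K s"
    and sU: "s \<in> U" and tV: "t \<in> V" and disj: "U \<inter> V = {}"
    and op: "openin (top_of_set ?T) U" "openin (top_of_set ?T) V"
    and pre: "{u \<in> ?T. curve K u \<in> \<phi> ` ball 0 1} = U \<union> V"
    and U: "inj_on (curve K) U" "curve K ` U = \<phi> ` {z \<in> ball 0 1. Im z = 0}"
    and V: "inj_on (curve K) V" "curve K ` V = \<phi> ` {z \<in> ball 0 1. Re z = 0}"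
    using tr unfolding transverse_def by (elim exE conjE) (rule that)
  have cont\<phi>: "continuous_on (cball 0 1) \<phi>" and inj: "inj_on \<phi> (cball 0 1)"
    using ch by (simp_all add: disc_chart_def)
  have "openin (top_of_set (cball 0 1)) (cball 0 1 \<inter> \<phi> -` (- C))"
    using cont\<phi> C(1) by (intro continuous_openin_preimage_gen) (auto simp: compact_imp_closed)
  moreover have "0 \<in> cball 0 1 \<inter> \<phi> -` (- C)" using \<phi>0 C(2) by simp
  ultimately obtain e where e: "e > 0" "ball 0 e \<inter> cball 0 1 \<subseteq> cball 0 1 \<inter> \<phi> -` (- C)"
    by (metis openin_contains_ball)
  \<comment> \<open>The bound 1 keeps the scaled disc in the domain of the chart, the bound
    \<open>e\<close> keeps it off \<open>C\<close>.\<close>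
  define \<epsilon> where "\<epsilon> = min 1 e"
  have \<epsilon>: "0 < \<epsilon>" "\<epsilon> \<le> 1" "\<epsilon> \<le> e" using e(1) by (auto simp: \<epsilon>_def)
  define \<psi> where "\<psi> = (\<lambda>z. \<phi> (of_real \<epsilon> * z))"
  have ch': "disc_chart A \<psi>" unfolding \<psi>_def by (rule disc_chart_shrink[OF ch \<epsilon>(1,2)])
  have scale: "of_real \<epsilon> * z \<in> ball 0 e \<inter> ball 0 1" if "z \<in> ball 0 1" for z :: complex
  proof -
    have "\<epsilon> * norm z < \<epsilon>" using that \<epsilon>(1) by simp
    from less_le_trans[OF this \<epsilon>(2)] less_le_trans[OF this \<epsilon>(3)]
    show ?thesis using \<epsilon>(1) by (simp add: norm_mult)
  qed
  have avoid: "x \<notin> C" if x: "x \<in> \<psi> ` ball 0 1" for x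
  proof -
    obtain z where z: "z \<in> ball 0 1" "x = \<phi> (of_real \<epsilon> * z)" using x by (auto simp: \<psi>_def)
    have "of_real \<epsilon> * z \<in> ball 0 e \<inter> cball 0 1"
      using scale[OF z(1)] ball_subset_cball by blast
    then show ?thesis using e(2) z(2) by auto
  qed
  have sub: "\<psi> ` ball 0 1 \<subseteq> \<phi> ` ball 0 1" using scale by (auto simp: \<psi>_def simp del: mem_ball)
  \<comment> \<open>The parameters seen in the shrunk disc; on them the old and the new curve
    coincide.\<close>
  define P where "P = {u \<in> ?T. curve K u \<in> \<psi> ` ball 0 1}"
  have opP: "openin (top_of_set ?T) P"
  proof -
    have "openin (top_of_set ?T) (?T \<inter> curve K -` (\<psi> ` ball 0 1))"
      using ch' im A by (intro continuous_openin_preimage[OF cont, of "surface A"]) (auto simp: disc_chart_def)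
    moreover have "?T \<inter> curve K -` (\<psi> ` ball 0 1) = P" by (auto simp: P_def)
    ultimately show ?thesis by simp
  qed
  have K'P: "curve K' u = curve K u" if "u \<in> P" for u
    using that out avoid by (simp add: P_def)
  have PUV: "P \<subseteq> U \<union> V" using pre sub unfolding P_def by blast
  \<comment> \<open>With a general \<open>f\<close>, both \<open>Im\<close> and \<open>Re\<close>
    are instances: an axis is the zero set of a function that scales with \<open>\<epsilon>\<close>,
    so shrinking preserves it.\<close>
  have axis: "curve K' ` (W \<inter> P) = \<psi> ` {z \<in> ball 0 1. f z = 0}"
    if W: "curve K ` W = \<phi> ` {z \<in> ball 0 1. f z = 0}" "W \<subseteq> ?T"
      and f: "\<And>z. f (of_real \<epsilon> * z) = \<epsilon> * f z" for W and f :: "complex \<Rightarrow> real"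
  proof -
    have "curve K' ` (W \<inter> P) = curve K ` (W \<inter> P)" using K'P by (intro image_cong) auto
    also have "\<dots> = curve K ` W \<inter> \<psi> ` ball 0 1" using W(2) by (auto simp: P_def)
    also have "\<dots> = \<psi> ` {z \<in> ball 0 1. f z = 0}"
    proof (intro equalityI subsetI)
      fix x assume x: "x \<in> curve K ` W \<inter> \<psi> ` ball 0 1"
      then obtain z w where z: "z \<in> ball 0 1" "x = \<phi> (of_real \<epsilon> * z)"
        and w: "w \<in> ball 0 1" "f w = 0" "x = \<phi> w"
        unfolding W(1) \<psi>_def by blast
      have "of_real \<epsilon> * z \<in> cball 0 1" "w \<in> cball 0 1"
        using scale[OF z(1)] w(1) by (simp_all add: less_imp_le)
      then have "w = of_real \<epsilon> * z" using z(2) w(3) inj_on_eq_iff[OF inj] by metis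
      then have "f z = 0" using w(2) f \<epsilon>(1) by simp
      then show "x \<in> \<psi> ` {z \<in> ball 0 1. f z = 0}" using z by (auto simp: \<psi>_def)
    next
      fix x assume "x \<in> \<psi> ` {z \<in> ball 0 1. f z = 0}"
      then obtain z where z: "z \<in> ball 0 1" "f z = 0" "x = \<psi> z" by blast
      have "of_real \<epsilon> * z \<in> {z \<in> ball 0 1. f z = 0}" using scale[OF z(1)] z(2) f by simp
      then have "\<psi> z \<in> curve K ` W" unfolding W(1) \<psi>_def by (rule imageI)
      then show "x \<in> curve K ` W \<inter> \<psi> ` ball 0 1" using z by blast
    qed
    finally show ?thesis .
  qed
  have UVT: "U \<subseteq> ?T" "V \<subseteq> ?T" using op openin_imp_subset by blast+
  have stT: "s \<in> ?T" "t \<in> ?T" "curve K s = curve K t" using st by (auto simp: double_points_def)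
  have \<psi>0: "\<psi> 0 = curve K s" by (simp add: \<psi>_def \<phi>0)
  then have "curve K s \<in> \<psi> ` ball 0 1" by (metis centre_in_ball imageI zero_less_one)
  then have sP: "s \<in> P" "t \<in> P" using stT by (simp_all add: P_def)
  have pre': "{u \<in> circles (comps K'). curve K' u \<in> \<psi> ` ball 0 1} = U \<inter> P \<union> V \<inter> P"
  proof -
    \<comment> \<open>No new strand can enter the shrunk disc, because what starts in
      \<open>C\<close> stays in \<open>C\<close>.\<close>
    have "curve K' u \<in> \<psi> ` ball 0 1 \<longleftrightarrow> curve K u \<in> \<psi> ` ball 0 1" if "u \<in> ?T" for u
      using that out[of u] ins[of u] avoid by metis
    then have "{u \<in> circles (comps K'). curve K' u \<in> \<psi> ` ball 0 1} = P"
      by (auto simp: P_def comps)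
    then show ?thesis using PUV by blast
  qed
  have injP: "inj_on (curve K') (W \<inter> P)" if "inj_on (curve K) W" for W
  proof -
    have "inj_on (curve K) (W \<inter> P)" using that by (rule inj_on_subset) blast
    then show ?thesis using K'P by (subst inj_on_cong[of _ _ "curve K"]) auto
  qed
  show ?thesis
    unfolding transverse_def
  proof (rule exI[of _ \<psi>], rule exI[of _ "U \<inter> P"], rule exI[of _ "V \<inter> P"], intro conjI)
    show "\<psi> 0 = curve K' s" using \<psi>0 K'P[OF sP(1)] by simp
    show "curve K' ` (U \<inter> P) = \<psi> ` {z \<in> ball 0 1. Im z = 0}"
      by (rule axis[OF U(2) UVT(1)]) simp
    show "curve K' ` (V \<inter> P) = \<psi> ` {z \<in> ball 0 1. Re z = 0}"
      by (rule axis[OF V(2) UVT(2)]) simp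
  qed (use ch' sU tV sP disj opP op pre' injP U(1) V(1) in \<open>auto simp: comps openin_Int\<close>)
qed

section \<open>Pasting new arcs into a disc\<close>

lemma compact_strand:
  assumes "tangle A K \<phi> n j" "i < n"
  shows "compact (j i ` {0..1})"
  using assms by (intro compact_continuous_image) (auto simp: tangle_def)

text \<open>Disjoint embedded arcs \<open>\<gamma>\<close> with the old end points may replace any
  tangle of the moving part: crossings inside disappear, and those outside keep their types.\<close>

lemma redraw:
  fixes \<gamma> :: "nat \<Rightarrow> real \<Rightarrow> complex"
  assumes A: "inner A \<subseteq> surface A" and K: "pseudo_diagram A K" and t: "tangle A K \<phi> n j"
    and moving: "strands n j \<inter> circles (nfixed A) = {}"
    and cont\<gamma>: "\<And>i. i < n \<Longrightarrow> continuous_on {0..1} (\<gamma> i)"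
    and ends: "\<And>i. i < n \<Longrightarrow> \<phi> (\<gamma> i 0) = curve K (j i 0) \<and> \<phi> (\<gamma> i 1) = curve K (j i 1)"
    and cball: "\<And>i x. i < n \<Longrightarrow> x \<in> {0..1} \<Longrightarrow> \<gamma> i x \<in> cball 0 1"
    and ball: "\<And>i x. i < n \<Longrightarrow> x \<in> {0<..<1} \<Longrightarrow> \<gamma> i x \<in> ball 0 1"
    and inj\<gamma>: "inj_on (\<lambda>(i, x). \<gamma> i x) ({..<n} \<times> {0..1})"
  obtains N where "pseudo_diagram A N" "local_change A K N \<phi> n j" "inner_doubles N n j = {}"
    "over N = outer_over K n j"
proof -
  let ?T = "circles (comps K)" and ?S = "strands n j" and ?C = "\<phi> ` cball 0 1"
  \<comment> \<open>Recovers the arc number and the arc parameter of a point on the strands.\<close>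
  define h where "h = inv_into ({..<n} \<times> {0..1}) (\<lambda>(i, x). j i x)"
  define c where "c u = (if u \<in> ?S then \<phi> (case h u of (i, x) \<Rightarrow> \<gamma> i x) else curve K u)" for u
  define N where "N = K\<lparr>curve := c, over := outer_over K n j\<rparr>"
  have N: "comps N = comps K" "curve N = c" "over N = outer_over K n j" by (simp_all add: N_def)
  have ch: "disc_chart A \<phi>" and injj: "inj_on (\<lambda>(i, x). j i x) ({..<n} \<times> {0..1})"
    using t by (simp_all add: tangle_def)
  have cont\<phi>: "continuous_on (cball 0 1) \<phi>" and inj\<phi>: "inj_on \<phi> (cball 0 1)"
    and im\<phi>: "?C \<subseteq> inner A" and op\<phi>: "openin (top_of_set (surface A)) (\<phi> ` ball 0 1)"
    using ch by (simp_all add: disc_chart_def)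
  have reg: "continuous_on ?T (curve K)" "curve K ` ?T \<subseteq> inner A" "finite (double_points K)"
    "\<And>s t. (s, t) \<in> double_points K \<Longrightarrow> transverse A K s t"
    using K by (auto simp: pseudo_diagram_def regular_diagram_def)
  note S_iff = tangle_strands[OF t]
  have jS: "j i x \<in> ?S" if "i < n" "x \<in> {0..1}" for i x
    using that unfolding strands_def by blast
  have cj: "c (j i x) = \<phi> (\<gamma> i x)" if "i < n" "x \<in> {0..1}" for i x
    using inv_into_f_f[OF injj, of "(i, x)"] jS that by (simp add: c_def h_def)
  have SE: "\<exists>i x. i < n \<and> x \<in> {0..1} \<and> u = j i x" if "u \<in> ?S" for u
    using that unfolding strands_def by blast
  have cS: "c u \<in> ?C" if "u \<in> ?S" for u
    using SE[OF that] cj cball by blast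
  have cT: "c u = curve K u" if "u \<notin> ?S" for u using that by (simp add: c_def)
  have cC: "c u \<in> ?C \<longleftrightarrow> u \<in> ?S" if "u \<in> ?T" for u
    using that cS cT S_iff by metis
  have cends: "c (j i 0) = curve K (j i 0)" "c (j i 1) = curve K (j i 1)" if "i < n" for i
    using that cj[of i 0] cj[of i 1] ends by simp_all
  have "continuous_on ?T c"
  proof -
    \<comment> \<open>The open disc is removed, not the closed one: \<open>?B\<close> is then
      closed, covers the circles together with \<open>?S\<close>, and overlaps it in end points
      only, where both descriptions of \<open>c\<close> agree. So the pieces can be pasted.\<close>
    let ?B = "{u \<in> ?T. curve K u \<notin> \<phi> ` ball 0 1}"
    have "continuous_on (j i ` {0..1}) c" if i: "i < n" for i
    proof -
      let ?g = "inv_into {0..1} (j i)"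
      have contj: "continuous_on {0..1} (j i)" using t i by (simp add: tangle_def)
      have "inj_on (j i) {0..1}"
        using inj_onD[OF injj, of "(i, x)" "(i, y)" for x y] i by (auto intro!: inj_onI)
      then have g: "?g (j i x) = x" if "x \<in> {0..1}" for x using that by simp
      have contg: "continuous_on (j i ` {0..1}) ?g"
        using contj g by (intro continuous_on_inv) auto
      have gim: "?g ` j i ` {0..1} = {0..1}" using g by (force simp: image_image)
      have "continuous_on (j i ` {0..1}) (\<phi> \<circ> (\<gamma> i \<circ> ?g))"
      proof (intro continuous_on_compose contg)
        show "continuous_on (?g ` j i ` {0..1}) (\<gamma> i)" unfolding gim by (rule cont\<gamma>[OF i])
        show "continuous_on ((\<gamma> i \<circ> ?g) ` j i ` {0..1}) \<phi>"
          using cball[OF i] by (intro continuous_on_subset[OF cont\<phi>]) (auto simp: g)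
      qed
      then show ?thesis
        by (rule continuous_on_eq) (use cj[OF i] g in auto)
    qed
    then have "continuous_on ?S c"
      unfolding strands_def using compact_strand[OF t]
      by (intro continuous_on_closed_Union) (auto simp: compact_imp_closed)
    moreover have "closed ?S"
      unfolding strands_def using compact_strand[OF t]
      by (intro closed_UN) (auto simp: compact_imp_closed)
    moreover have "continuous_on ?B c"
    proof (rule continuous_on_eq)
      show "continuous_on ?B (curve K)" using reg(1) by (rule continuous_on_subset) auto
      fix u assume u: "u \<in> ?B"
      show "curve K u = c u"
      proof (cases "u \<in> ?S")
        case True
        then obtain i x where ix: "i < n" "x \<in> {0..1}" "u = j i x" using SE by blast
        then have "x \<notin> {0<..<1}" using u t by (auto simp: tangle_def)
        then have "x = 0 \<or> x = 1" using ix(2) by auto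
        then show ?thesis using cends[OF ix(1)] ix(3) by auto
      qed (simp add: cT)
    qed
    moreover have "closed ?B"
    proof -
      have "openin (top_of_set ?T) (?T \<inter> curve K -` (\<phi> ` ball 0 1))"
        using reg(2) A op\<phi> by (intro continuous_openin_preimage[OF reg(1), of "surface A"]) auto
      then have "closedin (top_of_set ?T) (?T - (?T \<inter> curve K -` (\<phi> ` ball 0 1)))"
        by (intro closedin_diff closedin_subtopology_refl[THEN iffD2]) auto
      then have "closed (?T - (?T \<inter> curve K -` (\<phi> ` ball 0 1)))"
        by (rule closedin_closed_trans) (simp add: compact_circles compact_imp_closed)
      moreover have "?T - (?T \<inter> curve K -` (\<phi> ` ball 0 1)) = ?B" by auto
      ultimately show ?thesis by simp
    qed
    ultimately have "continuous_on (?S \<union> ?B) c" by (intro continuous_on_closed_Un)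
    moreover have "?S \<union> ?B = ?T"
      using S_iff ball_subset_cball[of "0 :: complex" 1] by blast
    ultimately show ?thesis by simp
  qed
  moreover have "c ` ?T \<subseteq> inner A"
  proof (rule image_subsetI)
    fix u assume "u \<in> ?T"
    then show "c u \<in> inner A"
      using subsetD[OF im\<phi> cS[of u]] subsetD[OF reg(2) imageI[of u]] cT[of u]
      by (cases "u \<in> ?S") simp_all
  qed
  moreover have dp: "double_points N \<subseteq> outer_doubles K n j"
  proof (rule subrelI)
    fix s t assume "(s, t) \<in> double_points N"
    then have st: "s \<in> ?T" "t \<in> ?T" "s \<noteq> t" "c s = c t" by (auto simp: double_points_def N)
    \<comment> \<open>A redrawn strand stays in the closed disc and all others stay outside, so a
      crossing of \<open>N\<close> is wholly inside, which injectivity of \<open>\<phi>\<close> and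
      \<open>\<gamma>\<close> forbids, or it is an old one.\<close>
    then have "s \<in> ?S \<longleftrightarrow> t \<in> ?S" using cC by metis
    moreover have "s \<notin> ?S \<or> t \<notin> ?S"
    proof (rule ccontr)
      assume "\<not> ?thesis"
      then obtain i x k y where *: "i < n" "x \<in> {0..1}" "s = j i x" "k < n" "y \<in> {0..1}" "t = j k y"
        using SE by metis
      then have "\<phi> (\<gamma> i x) = \<phi> (\<gamma> k y)" using st(4) cj by metis
      then have "\<gamma> i x = \<gamma> k y"
        using inj_onD[OF inj\<phi>] cball[OF *(1,2)] cball[OF *(4,5)] by blast
      then have "(i, x) = (k, y)" using inj_onD[OF inj\<gamma>, of "(i, x)" "(k, y)"] * by simp
      then show False using * st(3) by simp
    qed
    ultimately show "(s, t) \<in> outer_doubles K n j"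
      using st cT by (auto simp: double_points_def)
  qed
  moreover have "transverse A N s t" if st: "(s, t) \<in> double_points N" for s t
  proof (rule transverse_outside[OF A reg(1,2)])
    have K: "(s, t) \<in> outer_doubles K n j" using dp st by blast
    then show dpK: "(s, t) \<in> double_points K" by blast
    then show "transverse A K s t" by (rule reg(4))
    show "compact ?C" using cont\<phi> by (intro compact_continuous_image compact_cball)
    have "s \<notin> ?S" using K tangle_double_iff[OF t dpK] by blast
    then show "curve K s \<notin> ?C" using S_iff dpK by (auto simp: double_points_def)
    show "curve N u = curve K u" if "u \<in> ?T" "curve K u \<notin> ?C" for u
      using that S_iff cT by (simp add: N)
    show "curve N u \<in> ?C" if "u \<in> ?T" "curve K u \<in> ?C" for u
      using that S_iff cS by (simp add: N)
  qed (simp add: N)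
  ultimately have regN: "regular_diagram A N"
    using reg(3) finite_subset[of "double_points N" "double_points K"]
    by (auto simp: regular_diagram_def N)
  have tN: "tangle A N \<phi> n j"
  proof -
    have "{u \<in> circles (comps N). curve N u \<in> ?C} = ?S"
      unfolding N using cC S_iff by (intro set_eqI) (unfold mem_Collect_eq, metis)
    moreover have "curve N (j i x) \<in> \<phi> ` ball 0 1" if "i < n" "x \<in> {0<..<1}" for i x
      using that cj[of i x] ball[of i x] by (simp add: N)
    ultimately show ?thesis using t cends by (simp add: tangle_def N)
  qed
  have l: "local_change A K N \<phi> n j"
    using t tN cT cends by (simp add: local_change_def N)
  have inner: "inner_doubles N n j = {}" using dp by (auto simp: inner_doubles_def)
  have "pseudo_diagram A N"
    unfolding pseudo_diagram_def
  proof (intro conjI)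
    note dpN = local_change_double_points[OF l]
    have sub: "outer_over K n j \<subseteq> outer_doubles K n j" using pseudo_diagramD(2)[OF K] by blast
    show "over N \<subseteq> double_points N" using dpN sub by (auto simp: N)
    show "\<forall>(s, t) \<in> over N. (t, s) \<notin> over N" using pseudo_diagramD(3)[OF K] by (auto simp: N)
    show "nfixed A < comps N" using K by (simp add: pseudo_diagram_def N)
    show "\<forall>u \<in> circles (nfixed A). curve N u = fixed_curve A u"
    proof
      fix u assume u: "u \<in> circles (nfixed A)"
      then have "u \<notin> ?S" using moving by blast
      then show "curve N u = fixed_curve A u" using u K cT by (simp add: pseudo_diagram_def N)
    qed
    have "outer_over K n j \<inter> circles (nfixed A) \<times> circles (nfixed A) =
        over K \<inter> circles (nfixed A) \<times> circles (nfixed A)"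
      using moving by blast
    then show "over N \<inter> circles (nfixed A) \<times> circles (nfixed A) = fixed_over A"
      using K by (simp add: pseudo_diagram_def N)
    have "precrossings N \<subseteq> precrossings K"
      using dp by (auto simp: precrossings_def N)
    then show "\<forall>(s, t) \<in> precrossings N. s \<notin> circles (nfixed A) \<and> t \<notin> circles (nfixed A)"
      using K unfolding pseudo_diagram_def by blast
  qed (rule regN)
  then show thesis using l inner N(3) by (rule that)
qed

section \<open>Invariance under \<open>PR2\<close>\<close>

lemma tangle_same_curve:
  assumes "comps K' = comps K" "\<And>u. u \<in> circles (comps K) \<Longrightarrow> curve K' u = curve K u"
    and t: "tangle A K \<phi> n j"
  shows "tangle A K' \<phi> n j"
proof -
  have "{u \<in> circles (comps K'). curve K' u \<in> \<phi> ` cball 0 1} =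
      {u \<in> circles (comps K). curve K u \<in> \<phi> ` cball 0 1}"
    using assms(1,2) by (intro Collect_cong) auto
  moreover have "curve K' (j i x) = curve K (j i x)" if "i < n" "x \<in> {0..1}" for i x
  proof -
    have "j i x \<in> strands n j" using that unfolding strands_def by blast
    then show ?thesis using assms(2) by (simp add: tangle_strands[OF t])
  qed
  ultimately show ?thesis using t by (simp add: tangle_def)
qed

lemma double_points_same_curve:
  assumes "comps K' = comps K" "\<And>u. u \<in> circles (comps K) \<Longrightarrow> curve K' u = curve K u"
  shows "double_points K' = double_points K"
  using assms by (auto simp: double_points_def)

lemma local_change_same_curve:
  assumes c: "comps K' = comps K" "\<And>u. u \<in> circles (comps K) \<Longrightarrow> curve K' u = curve K u"
    and o: "outer_over K' n j = outer_over K n j" and l: "local_change A K N \<phi> n j"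
  shows "local_change A K' N \<phi> n j"
proof -
  have t: "tangle A K \<phi> n j" using l by (simp add: local_change_def)
  have "curve K' (j i x) = curve K (j i x)" if "i < n" "x \<in> {0..1}" for i x
  proof -
    have "j i x \<in> strands n j" using that unfolding strands_def by blast
    then show ?thesis using c(2) by (simp add: tangle_strands[OF t])
  qed
  then show ?thesis
    using l o c tangle_same_curve[OF c t] by (simp add: local_change_def)
qed

lemma local_change_refl: "tangle A K \<phi> n j \<Longrightarrow> local_change A K K \<phi> n j"
  by (simp add: local_change_def)

text \<open>In \<open>PR2\<close> the curves agree on the parameter circles, but as functions they
  may differ elsewhere. The resolution common to both sides is therefore matched by the constant
  isotopy, not by equality of records.\<close>

lemma isotopic_same_curve:
  assumes c: "comps K' = comps K" "\<And>u. u \<in> circles (comps K) \<Longrightarrow> curve K' u = curve K u"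
    and "over K' = over K"
  shows "isotopic A K K'"
proof -
  have "continuous_on ({0..1::real} \<times> surface A) (\<lambda>(r, x). x)"
    by (simp add: case_prod_unfold continuous_on_snd)
  then show ?thesis
    unfolding isotopic_def using assms
    by (intro exI[of _ "\<lambda>r x. x"] exI[of _ "\<lambda>x. x"])
      (auto simp: map_prod_def homeomorphism_ident intro!: exI[of _ "\<lambda>x. x"])
qed

text \<open>Component numbers are discrete and an arc is connected. Hence an arc with one point on
  the moving part lies there entirely.\<close>

lemma strand_component:
  assumes t: "tangle A K \<phi> n j" and "i < n" and u: "u \<in> j i ` {0..1}" and v: "v \<in> j i ` {0..1}"
  shows "fst u = fst v"
proof -
  define F where "F = fst ` j i ` {0..1}"
  have F: "fst u \<in> F" "fst v \<in> F" using u v by (simp_all only: F_def imageI)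
  have "continuous_on {0..1} (fst \<circ> j i)"
    using t \<open>i < n\<close> by (intro continuous_on_compose continuous_intros) (simp add: tangle_def)
  then have "connected ((fst \<circ> j i) ` {0..1})"
    by (intro connected_continuous_image) auto
  then have "connected F" by (simp add: F_def image_comp)
  from connectedD[OF this discrete_topology_class.open_discrete[of "{fst u}"]
      discrete_topology_class.open_discrete[of "- {fst u}"]]
  have "{fst u} \<inter> F = {} \<or> - {fst u} \<inter> F = {}" by auto
  with F show ?thesis by (metis Compl_iff disjoint_iff singleton_iff)
qed

lemma strands_disjoint:
  assumes "tangle A K \<phi> n j" "i < n" "k < n" "i \<noteq> k" "u \<in> j i ` {0..1}" "v \<in> j k ` {0..1}"
  shows "u \<noteq> v"
proof
  assume "u = v"
  then obtain x y where "x \<in> {0..1}" "y \<in> {0..1}" "j i x = j k y" using assms(5,6) by blast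
  then show False
    using inj_onD[of "\<lambda>(i, x). j i x" "{..<n} \<times> {0..1}" "(i, x)" "(k, y)"] assms(1-4)
    by (simp add: tangle_def)
qed

text \<open>The two arcs have disjoint parameters, and \<open>t = t'\<close> would make
  \<open>(s, s')\<close> a further double point in the disc.\<close>

lemma bigon_distinct:
  assumes t: "tangle A K \<phi> 2 j" and b: "bigon K j s t s' t'"
  shows "s \<noteq> t" "s \<noteq> t'" "s' \<noteq> t" "s' \<noteq> t'" "s \<noteq> s'" "t \<noteq> t'"
proof -
  have arcs: "s \<in> j 0 ` {0..1}" "s' \<in> j 0 ` {0..1}" "t \<in> j 1 ` {0..1}" "t' \<in> j 1 ` {0..1}"
    and ss': "s \<noteq> s'" and d: "inner_doubles K 2 j = {(s, t), (t, s), (s', t'), (t', s')}"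
    using b by (simp_all add: bigon_def)
  show ne: "s \<noteq> t" "s \<noteq> t'" "s' \<noteq> t" "s' \<noteq> t'"
    using strands_disjoint[OF t, of 0 1] arcs by auto
  show "s \<noteq> s'" by (rule ss')
  show "t \<noteq> t'"
  proof
    assume "t = t'"
    moreover have "(s, t) \<in> inner_doubles K 2 j" "(s', t') \<in> inner_doubles K 2 j" using d by auto
    ultimately have "(s, s') \<in> inner_doubles K 2 j"
      using ss' by (auto simp: inner_doubles_def double_points_def)
    then show False unfolding d using ne ss' by simp
  qed
qed

lemma flip_lessThan_2: "(\<lambda>i :: nat. 1 - i) ` {..<2} = {..<2}"
  by (auto simp: numeral_2_eq_2 lessThan_Suc)

lemma bigon_swap:
  assumes t: "tangle A K \<phi> 2 j" and b: "bigon K j s t s' t'"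
  shows "bigon K (\<lambda>i. j (1 - i)) t s t' s'"
proof -
  have "strands 2 (\<lambda>i. j (1 - i)) = strands 2 j" by (rule strands_permute[OF flip_lessThan_2])
  then have "inner_doubles K 2 (\<lambda>i. j (1 - i)) = inner_doubles K 2 j" by (simp add: inner_doubles_def)
  then show ?thesis
    using b bigon_distinct[OF t b] by (auto simp: bigon_def)
qed

text \<open>\<open>R2\<close> expects arc 0 to be the upper one; if it is arc 1, the map
  \<open>1 - i\<close> exchanges the numbers.\<close>

lemma R2_swap:
  assumes l: "local_change A K N \<phi> 2 j" and b: "bigon K j s t s' t'"
    and "(t, s) \<in> over K" "(t', s') \<in> over K" "inner_doubles N 2 j = {}"
  shows "R2 A K N"
proof -
  have "bij_betw (\<lambda>i :: nat. 1 - i) {..<2} {..<2}"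
    using flip_lessThan_2 by (simp add: bij_betw_def eq_card_imp_inj_on)
  then have "local_change A K N \<phi> 2 (\<lambda>i. j (1 - i))" by (rule local_change_permute[OF l])
  moreover have "tangle A K \<phi> 2 j" using l by (simp add: local_change_def)
  from bigon_swap[OF this b] have "bigon K (\<lambda>i. j (1 - i)) t s t' s'" .
  moreover have "inner_doubles N 2 (\<lambda>i. j (1 - i)) = {}"
    using assms(5) strands_permute[OF flip_lessThan_2, of j] by (simp add: inner_doubles_def)
  ultimately show ?thesis using assms(3,4) unfolding R2_def by blast
qed

text \<open>Strict convexity: inside a segment, the distance to the centre is smaller than at one of
  the ends.\<close>

lemma linepath_in_ball:
  fixes a b :: complex
  assumes "a \<in> sphere 0 1" "b \<in> sphere 0 1" "a \<noteq> b" "x \<in> {0<..<1}"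
  shows "linepath a b x \<in> ball 0 1"
proof -
  have "linepath a b x \<in> open_segment a b"
    using assms(3,4) by (auto simp: in_segment linepath_def)
  from dist_decreases_open_segment[OF this, of 0] show ?thesis using assms(1,2) by auto
qed

text \<open>The two arcs are replaced by the chords between their end points; these are disjoint because
  the end points of the two arcs lie on different half circles.\<close>

lemma bigon_straighten:
  assumes A: "inner A \<subseteq> surface A" and L: "link_diagram A L" and t: "tangle A L \<phi> 2 j"
    and ends: "\<And>x. x \<in> {0, 1} \<Longrightarrow> curve L (j 0 x) \<in> \<phi> ` {z \<in> sphere 0 1. Im z > 0} \<and>
                   curve L (j 1 x) \<in> \<phi> ` {z \<in> sphere 0 1. Im z < 0}"
    and b: "bigon L j s t s' t'" and moving: "s \<notin> circles (nfixed A)" "t \<notin> circles (nfixed A)"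
  obtains N where "link_diagram A N" "local_change A L N \<phi> 2 j" "inner_doubles N 2 j = {}"
proof -
  have arcs: "s \<in> j 0 ` {0..1}" "t \<in> j 1 ` {0..1}"
    and d: "inner_doubles L 2 j = {(s, t), (t, s), (s', t'), (t', s')}"
    and arcs': "s' \<in> j 0 ` {0..1}" "t' \<in> j 1 ` {0..1}"
    using b by (simp_all add: bigon_def)
  have "\<exists>z. z \<in> sphere 0 1 \<and> \<phi> z = curve L (j i x) \<and> (if i = 0 then Im z > 0 else Im z < 0)"
    if "i < 2" "x \<in> {0, 1}" for i x
  proof -
    have "i = 0 \<or> i = 1" using \<open>i < 2\<close> by linarith
    then show ?thesis using ends[OF \<open>x \<in> _\<close>] by (auto simp del: mem_sphere)
  qed
  then obtain p where p: "\<And>i x. i < 2 \<Longrightarrow> x \<in> {0, 1} \<Longrightarrow> p i x \<in> sphere 0 1 \<and>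
      \<phi> (p i x) = curve L (j i x) \<and> (if i = 0 then Im (p i x) > 0 else Im (p i x) < 0)"
    by metis
  define \<gamma> where "\<gamma> i = linepath (p i 0) (p i 1)" for i
  have jT: "j i x \<in> strands 2 j" if "i < 2" "x \<in> {0..1}" for i x
    using that unfolding strands_def by blast
  have injj: "inj_on (\<lambda>(i, x). j i x) ({..<2} \<times> {0..1})" using t by (simp add: tangle_def)
  \<comment> \<open>A degenerate chord would mean that the ends of one arc form a double point,
    while all double points in the disc join different arcs.\<close>
  have pne: "p i 0 \<noteq> p i 1" if i: "i < 2" for i
  proof
    assume "p i 0 = p i 1"
    then have "curve L (j i 0) = curve L (j i 1)" using p[OF i, of 0] p[OF i, of 1] by simp
    moreover have "j i 0 \<noteq> j i 1" using inj_onD[OF injj, of "(i, 0)" "(i, 1)"] i by auto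
    ultimately have "(j i 0, j i 1) \<in> inner_doubles L 2 j"
      using jT[OF i, of 0] jT[OF i, of 1] tangle_strands[OF t]
      by (simp add: inner_doubles_def double_points_def)
    then have "j i 0 = s \<and> j i 1 = t \<or> j i 0 = t \<and> j i 1 = s \<or>
        j i 0 = s' \<and> j i 1 = t' \<or> j i 0 = t' \<and> j i 1 = s'"
      unfolding d by simp
    then have "j i 0 \<in> j 0 ` {0..1} \<and> j i 1 \<in> j 1 ` {0..1} \<or>
        j i 0 \<in> j 1 ` {0..1} \<and> j i 1 \<in> j 0 ` {0..1}"
      using arcs arcs' by (elim disjE conjE) simp_all
    moreover have "w \<notin> j 0 ` {0..1} \<or> w \<notin> j 1 ` {0..1}" for w
      using strands_disjoint[OF t, of 0 1 w w] by auto
    moreover have "j i 0 \<in> j i ` {0..1}" "j i 1 \<in> j i ` {0..1}" by auto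
    moreover have "i = 0 \<or> i = 1" using i by linarith
    ultimately show False by metis
  qed
  \<comment> \<open>Open half planes are convex, so each chord stays on the side of its end
    points.\<close>
  have Im0: "Im (\<gamma> 0 x) > 0" and Im1: "Im (\<gamma> 1 x) < 0" if x: "x \<in> {0..1}" for x
  proof -
    have "\<gamma> 0 x \<in> closed_segment (p 0 0) (p 0 1)" "\<gamma> 1 x \<in> closed_segment (p 1 0) (p 1 1)"
      using x by (simp_all add: \<gamma>_def linepath_in_path)
    moreover have "closed_segment (p 0 0) (p 0 1) \<subseteq> {z. Im z > 0}"
      using p[of 0 0] p[of 0 1] by (intro closed_segment_subset convex_halfspace_Im_gt) auto
    moreover have "closed_segment (p 1 0) (p 1 1) \<subseteq> {z. Im z < 0}"
      using p[of 1 0] p[of 1 1] by (intro closed_segment_subset convex_halfspace_Im_lt) auto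
    ultimately show "Im (\<gamma> 0 x) > 0" "Im (\<gamma> 1 x) < 0" by blast+
  qed
  have inj\<gamma>: "inj_on (\<lambda>(i, x). \<gamma> i x) ({..<2} \<times> {0..1})"
  proof (rule inj_onI)
    fix u v
    assume uv: "u \<in> {..<2} \<times> {0..1}" "v \<in> {..<2} \<times> {0..1}"
      "(case u of (i, x) \<Rightarrow> \<gamma> i x) = (case v of (i, x) \<Rightarrow> \<gamma> i x)"
    obtain i x k y where "u = (i, x)" "v = (k, y)" by (cases u; cases v)
    with uv have *: "i \<in> {..<2}" "k \<in> {..<2}" "x \<in> {0..1}" "y \<in> {0..1}" "\<gamma> i x = \<gamma> k y"
      by auto
    have "i = 0 \<or> i = 1" "k = 0 \<or> k = 1" using *(1,2) by (auto simp: less_2_cases_iff)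
    then have "i = k" using Im0[OF *(3)] Im1[OF *(4)] Im0[OF *(4)] Im1[OF *(3)] *(5) by force
    then show "u = v"
      using inj_onD[OF inj_on_linepath[OF pne[of i]], of x y] * \<open>u = _\<close> \<open>v = _\<close>
      by (simp add: \<gamma>_def)
  qed
  have PL: "pseudo_diagram A L" and pre: "precrossings L = {}"
    using L by (simp_all add: link_diagram_def)
  \<comment> \<open>The crossing parameters \<open>s\<close> and \<open>t\<close> lie on moving
    components, one on each arc, and an arc cannot change component.\<close>
  have mv: "strands 2 j \<inter> circles (nfixed A) = {}"
  proof -
    have "circles (nfixed A) = {u \<in> circles (comps L). fst u < nfixed A}"
      using PL by (auto simp: circles_def pseudo_diagram_def)
    moreover have "s \<in> circles (comps L)" "t \<in> circles (comps L)"
      using d by (auto simp: inner_doubles_def double_points_def)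
    ultimately have ge: "\<not> fst s < nfixed A" "\<not> fst t < nfixed A" using moving by auto
    have "u \<notin> circles (nfixed A)" if "u \<in> strands 2 j" for u
    proof -
      have "u \<in> j 0 ` {0..1} \<or> u \<in> j 1 ` {0..1}"
        using that by (auto simp: strands_def less_2_cases_iff)
      then have "fst u = fst s \<or> fst u = fst t"
        using strand_component[OF t, of 0 u s] strand_component[OF t, of 1 u t] arcs by auto
      then show ?thesis using ge by (auto simp: circles_def)
    qed
    then show ?thesis by blast
  qed
  have cont: "continuous_on {0..1} (\<gamma> i)" for i
    unfolding \<gamma>_def by (rule continuous_on_linepath)
  have ends\<gamma>: "\<phi> (\<gamma> i 0) = curve L (j i 0) \<and> \<phi> (\<gamma> i 1) = curve L (j i 1)" if "i < 2" for i
    using p[OF that] by (simp add: \<gamma>_def linepath_0' linepath_1')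
  have ball: "\<gamma> i x \<in> ball 0 1" if "i < 2" "x \<in> {0<..<1}" for i x
    unfolding \<gamma>_def using p[OF that(1), of 0] p[OF that(1), of 1] pne[OF that(1)] that(2)
    by (intro linepath_in_ball) simp_all
  have cball: "\<gamma> i x \<in> cball 0 1" if "i < 2" "x \<in> {0..1}" for i x
  proof -
    have "\<gamma> i x \<in> closed_segment (p i 0) (p i 1)"
      using that(2) by (simp add: \<gamma>_def linepath_in_path)
    moreover have "closed_segment (p i 0) (p i 1) \<subseteq> cball 0 1"
      using p[OF that(1), of 0] p[OF that(1), of 1]
      by (intro closed_segment_subset convex_cball) simp_all
    ultimately show ?thesis by blast
  qed
  obtain N where N: "pseudo_diagram A N" "local_change A L N \<phi> 2 j"
    "inner_doubles N 2 j = {}" "over N = outer_over L 2 j"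
    by (rule redraw[OF A PL t mv cont ends\<gamma> cball ball inj\<gamma>])
  \<comment> \<open>Crossings of \<open>N\<close> lie outside the disc and come from
    \<open>L\<close>, where all are classical.\<close>
  have "(a, b) \<in> over N \<or> (b, a) \<in> over N" if "(a, b) \<in> double_points N" for a b
  proof -
    have "(a, b) \<notin> strands 2 j \<times> strands 2 j" using that N(3) by (auto simp: inner_doubles_def)
    moreover from this have "(a, b) \<in> double_points L"
      using that local_change_double_points[OF N(2)] by blast
    moreover from this have "(a, b) \<in> over L \<or> (b, a) \<in> over L"
      using pre unfolding precrossings_def by blast
    ultimately show ?thesis using N(4) by auto
  qed
  then have "link_diagram A N" using N(1) by (auto simp: link_diagram_def precrossings_def)
  then show thesis using N(2,3) by (rule that)
qed

section \<open>Comparing the resolutions of the two bigons\<close>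

lemma choices_two_crossings:
  assumes "s \<noteq> t" "s \<noteq> t'" "s' \<noteq> t" "s' \<noteq> t'" "s \<noteq> s'" "t \<noteq> t'"
  shows "choices {(s, t), (t, s), (s', t'), (t', s')} {(s', t')} =
    {{(s, t), (s', t')}, {(t, s), (s', t')}}" (is "choices ?D _ = _")
proof (intro equalityI subsetI)
  fix X assume X: "X \<in> choices ?D {(s', t')}"
  have "(s', t') \<in> X" "X \<subseteq> ?D" using choicesD(1,2)[OF X] by auto
  moreover have "(s, t) \<in> X \<longleftrightarrow> (t, s) \<notin> X" "(s', t') \<in> X \<longleftrightarrow> (t', s') \<notin> X"
    by (rule choicesD(3)[OF X]; simp)+
  ultimately show "X \<in> {{(s, t), (s', t')}, {(t, s), (s', t')}}" by blast
next
  fix X assume "X \<in> {{(s, t), (s', t')}, {(t, s), (s', t')}}"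
  then show "X \<in> choices ?D {(s', t')}" using assms by (auto simp: choices_def)
qed

lemma PR2_class_pmf:
  assumes A: "inner A \<subseteq> surface A"
    and K: "pseudo_diagram A K" and K': "pseudo_diagram A K'" and "PR2 A K K'"
  shows "class_pmf A K = class_pmf A K'"
proof -
  obtain \<phi> j s t s' t' where tan: "tangle A K \<phi> 2 j"
    and ends: "\<And>x. x \<in> {0, 1} \<Longrightarrow> curve K (j 0 x) \<in> \<phi> ` {z \<in> sphere 0 1. Im z > 0} \<and>
                   curve K (j 1 x) \<in> \<phi> ` {z \<in> sphere 0 1. Im z < 0}"
    and c: "comps K' = comps K" "\<And>u. u \<in> circles (comps K) \<Longrightarrow> curve K' u = curve K u"
    and b: "bigon K j s t s' t'" and pre: "(s, t) \<in> precrossings K" and o: "(s', t') \<in> over K"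
    and o': "over K' = insert (t, s) (over K - {(s', t')})"
    using assms(4) unfolding PR2_def by blast
  let ?S = "strands 2 j"
  note ne = bigon_distinct[OF tan b]
  have d: "inner_doubles K 2 j = {(s, t), (t, s), (s', t'), (t', s')}"
    using b by (simp add: bigon_def)
  have d': "inner_doubles K' 2 j = {(s, t), (t, s), (s', t'), (t', s')}"
    using d double_points_same_curve[OF c] by (simp add: inner_doubles_def)
  have st: "s \<in> ?S" "t \<in> ?S" "s' \<in> ?S" "t' \<in> ?S" using d by (auto simp: inner_doubles_def)
  \<comment> \<open>Precrossings avoid the fixed link; this is what permits redrawing both
    arcs.\<close>
  have moving: "s \<notin> circles (nfixed A)" "t \<notin> circles (nfixed A)"
    using K pre by (auto simp: pseudo_diagram_def)
  have io: "inner_over K 2 j = {(s', t')}"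
  proof -
    have "inner_over K 2 j \<subseteq> inner_doubles K 2 j"
      using pseudo_diagramD(2)[OF K] by (auto simp: inner_doubles_def)
    moreover have "(s, t) \<notin> over K" "(t, s) \<notin> over K" using pre by (auto simp: precrossings_def)
    moreover have "(t', s') \<notin> over K" using pseudo_diagramD(3)[OF K o] .
    ultimately show ?thesis using d o st by auto
  qed
  have io': "inner_over K' 2 j = {(t, s)}" using io st unfolding o' by auto
  have oo: "outer_over K' 2 j = outer_over K 2 j" using st unfolding o' by auto
  have l: "local_change A K K' \<phi> 2 j"
    by (rule local_change_sym, rule local_change_same_curve[OF c oo local_change_refl[OF tan]])
  \<comment> \<open>In \<open>?E\<close> arc 0 is over twice, in \<open>?E'\<close> arc 1 is over
    twice, and \<open>?M\<close> is the alternating twist common to both sides.\<close>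
  let ?E = "{(s, t), (s', t')}" and ?M = "{(t, s), (s', t')}" and ?E' = "{(t, s), (t', s')}"
  have ch: "choices (inner_doubles K 2 j) (inner_over K 2 j) = {?E, ?M}"
    unfolding d io by (rule choices_two_crossings[OF ne])
  have ch': "choices (inner_doubles K' 2 j) (inner_over K' 2 j) = {?E', ?M}"
  proof -
    have "{(s, t), (t, s), (s', t'), (t', s')} = {(t', s'), (s', t'), (t, s), (s, t)}" by auto
    then show ?thesis
      unfolding d' io' using choices_two_crossings[of t' s' s t] ne by (simp add: insert_commute)
  qed
  show ?thesis
  proof (rule class_pmf_local[OF K K' l])
    fix X assume X: "X \<in> choices (outer_doubles K 2 j) (outer_over K 2 j)"
    have X': "X \<in> choices (outer_doubles K' 2 j) (outer_over K' 2 j)"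
      using X oo local_change_double_points[OF l] by simp
    have mem: "?E \<in> choices (inner_doubles K 2 j) (inner_over K 2 j)"
      "?M \<in> choices (inner_doubles K 2 j) (inner_over K 2 j)"
      "?E' \<in> choices (inner_doubles K' 2 j) (inner_over K' 2 j)"
      "?M \<in> choices (inner_doubles K' 2 j) (inner_over K' 2 j)" by (simp_all add: ch ch')
    have M: "link_class A (K\<lparr>over := X \<union> ?M\<rparr>) = link_class A (K'\<lparr>over := X \<union> ?M\<rparr>)"
    proof (rule link_step_class)
      have "isotopic A (K\<lparr>over := X \<union> ?M\<rparr>) (K'\<lparr>over := X \<union> ?M\<rparr>)"
        by (rule isotopic_same_curve) (simp_all add: c)
      then show "link_step A (K\<lparr>over := X \<union> ?M\<rparr>) (K'\<lparr>over := X \<union> ?M\<rparr>)"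
        using link_diagram_outer_inner[OF K X mem(2)] link_diagram_outer_inner[OF K' X' mem(4)]
        by (simp add: link_step_def)
    qed
    let ?L = "K\<lparr>over := X \<union> ?E\<rparr>" and ?L' = "K'\<lparr>over := X \<union> ?E'\<rparr>"
    have L: "link_diagram A ?L" by (rule link_diagram_outer_inner[OF K X mem(1)])
    have L': "link_diagram A ?L'" by (rule link_diagram_outer_inner[OF K' X' mem(3)])
    have bL: "bigon ?L j s t s' t'" using b by (simp add: bigon_def)
    have bL': "bigon ?L' j s t s' t'" using b d' by (simp add: bigon_def)
    \<comment> \<open>One \<open>N\<close> serves both sides: \<open>?L\<close> and
      \<open>?L'\<close> have the same curves on the circles and differ in crossing types only
      inside the disc.\<close>
    obtain N where N: "link_diagram A N" "local_change A ?L N \<phi> 2 j" "inner_doubles N 2 j = {}"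
      using bigon_straighten[OF A L, of \<phi> j s t s' t'] tan ends bL moving by auto
    have "(s, t) \<in> over ?L" "(s', t') \<in> over ?L" by simp_all
    then have "R2 A ?L N" unfolding R2_def using N(2,3) bL by blast
    then have "link_step A ?L N" using L N(1) by (simp add: link_step_def)
    moreover have "R2 A ?L' N"
    proof (rule R2_swap[OF _ bL' _ _ N(3)])
      show "local_change A ?L' N \<phi> 2 j"
        using outer_inner_Diff[OF X mem(1)] outer_inner_Diff[OF X' mem(3)]
        by (intro local_change_same_curve[OF _ _ _ N(2)]) (simp_all add: c)
    qed auto
    then have "link_step A ?L' N" using L' N(1) by (simp add: link_step_def)
    ultimately have E: "link_class A ?L = link_class A ?L'"
      using link_step_class by metis
    have "?E \<noteq> ?M" "?E' \<noteq> ?M" using ne by auto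
    then show "map_pmf (\<lambda>Y. link_class A (K\<lparr>over := X \<union> Y\<rparr>))
        (pmf_of_set (choices (inner_doubles K 2 j) (inner_over K 2 j))) =
      map_pmf (\<lambda>Y. link_class A (K'\<lparr>over := X \<union> Y\<rparr>))
        (pmf_of_set (choices (inner_doubles K' 2 j) (inner_over K' 2 j)))"
      \<comment> \<open>One face of the coin pairs \<open>?E\<close> with \<open>?E'\<close>, the
        other pairs \<open>?M\<close> with itself.\<close>
      by (simp only: ch ch' map_pmf_of_set_pair[OF \<open>?E \<noteq> ?M\<close>] map_pmf_of_set_pair[OF \<open>?E' \<noteq> ?M\<close>] E M)
  qed
qed

section \<open>The WeRe set\<close>

lemma pseudo_step_class_pmf:
  assumes A: "inner A \<subseteq> surface A" and "pseudo_step A K K'"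
  shows "class_pmf A K = class_pmf A K'"
proof -
  have K: "pseudo_diagram A K" "pseudo_diagram A K'"
    and "isotopic A K K' \<or> R1 A K K' \<or> R2 A K K' \<or> R3 A K K' \<or>
      PR1 A K K' \<or> PR2 A K K' \<or> PR3 A K K' \<or> PR3' A K K'"
    using assms(2) by (simp_all add: pseudo_step_def)
  then consider "isotopic A K K'" | s t where "kink_removal A K K' s t" | "R2 A K K'"
    | "R3 A K K' \<or> PR3 A K K' \<or> PR3' A K K'" | "PR2 A K K'"
    unfolding R1_def PR1_def by blast
  then show ?thesis
    by cases (use K A isotopic_class_pmf kink_removal_class_pmf R2_class_pmf R3_PR3_class_pmf
        PR2_class_pmf in blast)+
qed

text \<open>The induction along the chain of steps is run on \<open>class_pmf\<close>; each step
  itself supplies the diagram conditions at intermediate stages.\<close>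

lemma pseudo_equiv_WeRe:
  assumes A: "inner A \<subseteq> surface A" and K: "pseudo_diagram A K" "pseudo_diagram A K'"
    and "pseudo_equiv A K K'"
  shows "WeRe A K = WeRe A K'"
proof -
  have "class_pmf A K = class_pmf A K'"
    using assms(4) unfolding pseudo_equiv_def
    by (induction rule: equivclp_induct) (auto dest: pseudo_step_class_pmf[OF A])
  then show ?thesis by (simp add: WeRe_class_pmf K)
qed

theorem theorem3:
  shows
    "(\<forall>K K'. pseudo_diagram annulus K \<and> pseudo_diagram annulus K' \<and> pseudo_equiv annulus K K' \<longrightarrow>
        WeRe annulus K = WeRe annulus K' \<and>
        (\<forall>f :: (complex \<times> real) diagram \<Rightarrow> 'a. link_invariant annulus f \<longrightarrow>
           WeRe_values annulus f K = WeRe_values annulus f K')) \<and>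
     (\<forall>K K'. pseudo_diagram torus K \<and> pseudo_diagram torus K' \<and> pseudo_equiv torus K K' \<longrightarrow>
        WeRe torus K = WeRe torus K' \<and>
        (\<forall>f :: (complex \<times> complex) diagram \<Rightarrow> 'b. link_invariant torus f \<longrightarrow>
           WeRe_values torus f K = WeRe_values torus f K')) \<and>
     (\<forall>K K'. pseudo_diagram O_mixed K \<and> pseudo_diagram O_mixed K' \<and> pseudo_equiv O_mixed K K' \<longrightarrow>
        WeRe O_mixed K = WeRe O_mixed K' \<and>
        (\<forall>f :: complex diagram \<Rightarrow> 'c. link_invariant O_mixed f \<longrightarrow>
           WeRe_values O_mixed f K = WeRe_values O_mixed f K')) \<and>
     (\<forall>K K'. pseudo_diagram H_mixed K \<and> pseudo_diagram H_mixed K' \<and> pseudo_equiv H_mixed K K' \<longrightarrow>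
        WeRe H_mixed K = WeRe H_mixed K' \<and>
        (\<forall>f :: complex diagram \<Rightarrow> 'd. link_invariant H_mixed f \<longrightarrow>
           WeRe_values H_mixed f K = WeRe_values H_mixed f K'))"
proof -
  have "inner annulus \<subseteq> surface annulus" "inner torus \<subseteq> surface torus"
    "inner O_mixed \<subseteq> surface O_mixed" "inner H_mixed \<subseteq> surface H_mixed"
    by (auto simp: annulus_def torus_def O_mixed_def H_mixed_def)
  note WeRe = this[THEN pseudo_equiv_WeRe]
  \<comment> \<open>\<open>WeRe_values\<close> reads the diagram only through its WeRe set, so the
    statements on invariants follow by substitution.\<close>
  show ?thesis by (auto simp: WeRe_values_def dest: WeRe)
qed

end
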